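(* Let $\mathcal{A}:[1,\infty)\to[1,\infty)$ be a differentiable, convex, increasing function with $\mathcal{A}(t)\ge c\,t^p$ for all $t\geq 1$, for some constants $c>0$, $p>1$, and with $c_0\mathcal{A}(t)\le t\mathcal{A}'(t)\le c_1\mathcal{A}(t)$ for all $t\geq 1$, for some constants $c_0,c_1>0$. Let $\eta\in C^\infty(\mathbb{D})\cap L^1(\mathbb{D})$, $\eta\ge1$. Let $f\in\mathsf{F}_{\mathcal{A},\eta}$ be a minimiser which is not a self-homeomorphism of $\overline{\mathbb{D}}$, with topologically monotone pseudo-inverse $h:\overline{\mathbb{D}}\to\overline{\mathbb{D}}$, such that $h$ is a diffeomorphism from $\Omega=f(\mathbb{D})$ onto $\mathbb{D}$ and $h$ satisfies $$\Phi=\mathcal{A}'(\mathbb{K}(w,h))\,h_w\,\overline{h_{\overline w}}\,\eta(h)$$ with $\Phi$ holomorphic in $\mathbb{D}$. Let $Z=\{z\in\mathbb{S}: h^{-1}(z)\text{ is not a singleton}\}$. Then $Z$ has Hausdorff measure $\mathcal{H}^1(Z)=0$.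
   Context: $\mathbb{D}$ is the open unit disk in $\mathbb{C}$, $\mathbb{S}=\partial\mathbb{D}$; $dz,dw$ denote Lebesgue area measure; $\mathcal{H}^1$ is one-dimensional Hausdorff measure. For a map $f$, $f_z,f_{\overline z}$ are the complex derivatives and $J(z,f)=|f_z|^2-|f_{\overline z}|^2$. A map $f$ has finite distortion if $f\in W^{1,1}_{loc}(\mathbb{D})$, $J(z,f)\in L^1_{loc}(\mathbb{D})$ and $\mathbb{K}(z,f)=\frac{|f_z|^2+|f_{\overline z}|^2}{|f_z|^2-|f_{\overline z}|^2}$ is finite a.e.; the convention is $\mathbb{K}=1$ where $Df=0$. A continuous map is (topologically) monotone if the preimage of each point is connected. Energies: $\mathsf{E}_{\mathcal{A},\eta}(f)=\int_{\mathbb{D}}\mathcal{A}(\mathbb{K}(z,f))\,\eta(z)\,dz$ and $\mathsf{E}^*_{\mathcal{A},\eta}(h)=\int_{\mathbb{D}}\mathcal{A}(\mathbb{K}(w,h))\,J(w,h)\,\eta(h)\,dw$ (expressions involving $\eta(h)$ are understood to be $0$ where $Dh=0$). Enlarged spaces: let $f_0:\overline{\mathbb{D}}\to\overline{\mathbb{D}}$ be a homeomorphism of finite distortion with $\mathsf{E}_{\mathcal{A},\eta}(f_0)<\infty$ and $h_0=f_0^{-1}$. $\mathsf{F}_{\mathcal{A},\eta}$ is the space of maps $f:\mathbb{D}\to\mathbb{D}$ such that: (1) $f\in W^{1,q}(\mathbb{D},\mathbb{D})$ with $q=\frac{2p}{p+1}$ and $\|Df\|_{L^q(\mathbb{D})}\le\|Df_0\|_{L^q(\mathbb{D})}+1$;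 (2) there is $h\in C(\overline{\mathbb{D}})$ of finite distortion with $h|_{\mathbb{S}}=h_0|_{\mathbb{S}}$ and $\mathsf{E}^*_{\mathcal{A},\eta}(h)\le\mathsf{E}^*_{\mathcal{A},\eta}(h_0)+1$; (3) there is a dense set $X\subset\mathbb{D}$ of full measure such that $h\circ f(z)=z$ for every $z\in X$, and $J(w,h)=0$ for almost every $w\in\mathbb{D}\setminus f(X)$. $\mathsf{H}_{\mathcal{A},\eta}$ is the space of all such pseudo-inverses $h$. A minimiser is $f\in\mathsf{F}_{\mathcal{A},\eta}$ whose pseudo-inverse $h$ satisfies $\mathsf{E}^*_{\mathcal{A},\eta}(h)=\min_{g\in\mathsf{H}_{\mathcal{A},\eta}}\mathsf{E}^*_{\mathcal{A},\eta}(g)$. *)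

theory Defs
  imports "HOL-Analysis.Analysis"
begin

text \<open>Meant for open \<open>U\<close>. In finite dimensions, asking that every directional derivative be
  of class \<open>C\<^sup>k\<close> is the same as asking it of the derivative itself.\<close>

primrec ck_on :: "nat \<Rightarrow> 'a::euclidean_space set \<Rightarrow> ('a \<Rightarrow> 'b::real_normed_vector) \<Rightarrow> bool" where
  "ck_on 0 U g \<longleftrightarrow> continuous_on U g"
| "ck_on (Suc k) U g \<longleftrightarrow>
     (\<forall>x\<in>U. g differentiable (at x)) \<and> (\<forall>v. ck_on k U (\<lambda>x. frechet_derivative g (at x) v))"

definition smooth_on :: "'a::euclidean_space set \<Rightarrow> ('a \<Rightarrow> 'b::real_normed_vector) \<Rightarrow> bool" where
  "smooth_on U g \<longleftrightarrow> (\<forall>k. ck_on k U g)"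

definition diffeomorphism_onto ::
    "'a::euclidean_space set \<Rightarrow> 'b::euclidean_space set \<Rightarrow> ('a \<Rightarrow> 'b) \<Rightarrow> bool" where
  "diffeomorphism_onto U V h \<longleftrightarrow> open U \<and> open V \<and>
     (\<exists>g. homeomorphism U V h g \<and> ck_on 1 U h \<and> ck_on 1 V g)"

definition locally_integrable ::
    "'a::euclidean_space set \<Rightarrow> ('a \<Rightarrow> 'b::euclidean_space) \<Rightarrow> bool" where
  "locally_integrable U f \<longleftrightarrow> (\<forall>K. compact K \<and> K \<subseteq> U \<longrightarrow> integrable (lebesgue_on K) f)"

definition test_function :: "'a::euclidean_space set \<Rightarrow> ('a \<Rightarrow> real) \<Rightarrow> bool" where
  "test_function U \<phi> \<longleftrightarrow> smooth_on UNIV \<phi> \<and> (\<exists>K. compact K \<and> K \<subseteq> U \<and> (\<forall>x. x \<notin> K \<longrightarrow> \<phi> x = 0))"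

definition has_weak_derivative ::
    "'a::euclidean_space set \<Rightarrow> ('a \<Rightarrow> 'b::euclidean_space) \<Rightarrow> 'a \<Rightarrow> ('a \<Rightarrow> 'b) \<Rightarrow> bool" where
  "has_weak_derivative U f v g \<longleftrightarrow> locally_integrable U f \<and> locally_integrable U g \<and>
     (\<forall>\<phi>. test_function U \<phi> \<longrightarrow>
        (\<integral>x. frechet_derivative \<phi> (at x) v *\<^sub>R f x \<partial>lebesgue_on U) =
        - (\<integral>x. \<phi> x *\<^sub>R g x \<partial>lebesgue_on U))"

text \<open>A representative of the weak derivative in direction \<open>v\<close>. It is determined only up to a
  null set, and arbitrary if no weak derivative exists.\<close>

definition weak_derivative ::
    "'a::euclidean_space set \<Rightarrow> ('a \<Rightarrow> 'b::euclidean_space) \<Rightarrow> 'a \<Rightarrow> 'a \<Rightarrow> 'b" where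
  "weak_derivative U f v = (SOME g. has_weak_derivative U f v g)"

definition W11_loc :: "'a::euclidean_space set \<Rightarrow> ('a \<Rightarrow> 'b::euclidean_space) \<Rightarrow> bool" where
  "W11_loc U f \<longleftrightarrow> (\<forall>v\<in>Basis. \<exists>g. has_weak_derivative U f v g)"

definition in_Lq ::
    "'a::euclidean_space set \<Rightarrow> real \<Rightarrow> ('a \<Rightarrow> 'b::euclidean_space) \<Rightarrow> bool" where
  "in_Lq U q f \<longleftrightarrow> f \<in> borel_measurable (lebesgue_on U) \<and>
     integrable (lebesgue_on U) (\<lambda>x. norm (f x) powr q)"

definition W1q ::
    "'a::euclidean_space set \<Rightarrow> real \<Rightarrow> ('a \<Rightarrow> 'b::euclidean_space) \<Rightarrow> bool" where
  "W1q U q f \<longleftrightarrow> W11_loc U f \<and> in_Lq U q f \<and> (\<forall>v\<in>Basis. in_Lq U q (weak_derivative U f v))"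

abbreviation disk :: "complex set" where "disk \<equiv> ball 0 1"
abbreviation closed_disk :: "complex set" where "closed_disk \<equiv> cball 0 1"
abbreviation circle :: "complex set" where "circle \<equiv> sphere 0 1"

definition dz :: "(complex \<Rightarrow> complex) \<Rightarrow> complex \<Rightarrow> complex" where
  "dz f z = (weak_derivative disk f 1 z - \<i> * weak_derivative disk f \<i> z) / 2"

definition dzbar :: "(complex \<Rightarrow> complex) \<Rightarrow> complex \<Rightarrow> complex" where
  "dzbar f z = (weak_derivative disk f 1 z + \<i> * weak_derivative disk f \<i> z) / 2"

definition D_zero :: "(complex \<Rightarrow> complex) \<Rightarrow> complex \<Rightarrow> bool" where
  "D_zero f z \<longleftrightarrow> dz f z = 0 \<and> dzbar f z = 0"

definition jac :: "(complex \<Rightarrow> complex) \<Rightarrow> complex \<Rightarrow> real" where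
  "jac f z = (cmod (dz f z))\<^sup>2 - (cmod (dzbar f z))\<^sup>2"

text \<open>The value \<open>\<infinity>\<close> is also given where the Jacobian is negative, where the quotient would be a
  negative number; finite distortion thus includes the usual requirement that the Jacobian be
  positive almost everywhere that the derivative does not vanish.\<close>

definition distortion :: "(complex \<Rightarrow> complex) \<Rightarrow> complex \<Rightarrow> ereal" where
  "distortion f z =
     (if D_zero f z then 1
      else if jac f z > 0 then ereal (((cmod (dz f z))\<^sup>2 + (cmod (dzbar f z))\<^sup>2) / jac f z)
      else \<infinity>)"

definition finite_distortion :: "(complex \<Rightarrow> complex) \<Rightarrow> bool" where
  "finite_distortion f \<longleftrightarrow> W11_loc disk f \<and> locally_integrable disk (jac f) \<and>
     (AE z in lebesgue_on disk. distortion f z < \<infinity>)"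

text \<open>With \<open>f\<^sub>x\<close>, \<open>f\<^sub>y\<close> the partial derivatives, the squared Hilbert-Schmidt norm of the
  differential is \<open>\<bar>f\<^sub>x\<bar>\<^sup>2 + \<bar>f\<^sub>y\<bar>\<^sup>2\<close>, which equals twice the sum of \<open>\<bar>dz f\<bar>\<^sup>2\<close> and \<open>\<bar>dzbar f\<bar>\<^sup>2\<close>.\<close>

definition D_Lq_norm :: "real \<Rightarrow> (complex \<Rightarrow> complex) \<Rightarrow> real" where
  "D_Lq_norm q f =
     (\<integral>z. sqrt (2 * (cmod (dz f z))\<^sup>2 + 2 * (cmod (dzbar f z))\<^sup>2) powr q \<partial>lebesgue_on disk)
       powr (1 / q)"

definition energy ::
    "(real \<Rightarrow> real) \<Rightarrow> (complex \<Rightarrow> real) \<Rightarrow> (complex \<Rightarrow> complex) \<Rightarrow> ennreal" where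
  "energy A \<eta> f =
     (\<integral>\<^sup>+ z. ennreal (A (real_of_ereal (distortion f z)) * \<eta> z) \<partial>lebesgue_on disk)"

definition energy_star ::
    "(real \<Rightarrow> real) \<Rightarrow> (complex \<Rightarrow> real) \<Rightarrow> (complex \<Rightarrow> complex) \<Rightarrow> ennreal" where
  "energy_star A \<eta> h =
     (\<integral>\<^sup>+ w. (if D_zero h w then 0
             else ennreal (A (real_of_ereal (distortion h w)) * jac h w * \<eta> (h w)))
       \<partial>lebesgue_on disk)"

definition pseudo_inverse ::
    "(real \<Rightarrow> real) \<Rightarrow> (complex \<Rightarrow> real) \<Rightarrow> (complex \<Rightarrow> complex) \<Rightarrow>
     (complex \<Rightarrow> complex) \<Rightarrow> (complex \<Rightarrow> complex) \<Rightarrow> bool" where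
  "pseudo_inverse A \<eta> h0 f h \<longleftrightarrow>
     continuous_on closed_disk h \<and> finite_distortion h \<and> (\<forall>w\<in>circle. h w = h0 w) \<and>
     energy_star A \<eta> h \<le> energy_star A \<eta> h0 + 1 \<and>
     (\<exists>X. X \<subseteq> disk \<and> disk \<subseteq> closure X \<and> negligible (disk - X) \<and> (\<forall>z\<in>X. h (f z) = z) \<and>
          (AE w in lebesgue_on disk. w \<notin> f ` X \<longrightarrow> jac h w = 0))"

definition F_space ::
    "(real \<Rightarrow> real) \<Rightarrow> (complex \<Rightarrow> real) \<Rightarrow> real \<Rightarrow>
     (complex \<Rightarrow> complex) \<Rightarrow> (complex \<Rightarrow> complex) \<Rightarrow> (complex \<Rightarrow> complex) set" where
  "F_space A \<eta> p f0 h0 =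
     {f. f ` disk \<subseteq> disk \<and> W1q disk (2 * p / (p + 1)) f \<and>
         D_Lq_norm (2 * p / (p + 1)) f \<le> D_Lq_norm (2 * p / (p + 1)) f0 + 1 \<and>
         (\<exists>h. pseudo_inverse A \<eta> h0 f h)}"

definition H_space ::
    "(real \<Rightarrow> real) \<Rightarrow> (complex \<Rightarrow> real) \<Rightarrow> real \<Rightarrow>
     (complex \<Rightarrow> complex) \<Rightarrow> (complex \<Rightarrow> complex) \<Rightarrow> (complex \<Rightarrow> complex) set" where
  "H_space A \<eta> p f0 h0 = {h. \<exists>f\<in>F_space A \<eta> p f0 h0. pseudo_inverse A \<eta> h0 f h}"

definition minimiser ::
    "(real \<Rightarrow> real) \<Rightarrow> (complex \<Rightarrow> real) \<Rightarrow> real \<Rightarrow> (complex \<Rightarrow> complex) \<Rightarrow>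
     (complex \<Rightarrow> complex) \<Rightarrow> (complex \<Rightarrow> complex) \<Rightarrow> (complex \<Rightarrow> complex) \<Rightarrow> bool" where
  "minimiser A \<eta> p f0 h0 f h \<longleftrightarrow>
     f \<in> F_space A \<eta> p f0 h0 \<and> pseudo_inverse A \<eta> h0 f h \<and>
     (\<forall>g\<in>H_space A \<eta> p f0 h0. energy_star A \<eta> h \<le> energy_star A \<eta> g)"

text \<open>The values of \<open>f\<close> outside the open disk are irrelevant, so being a self-homeomorphism of
  the closed disk means extending to one.\<close>

definition extends_to_self_homeomorphism :: "(complex \<Rightarrow> complex) \<Rightarrow> bool" where
  "extends_to_self_homeomorphism f \<longleftrightarrow>
     (\<exists>F G. homeomorphism closed_disk closed_disk F G \<and> (\<forall>z\<in>disk. F z = f z))"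

text \<open>Meant for \<open>s > 0\<close>, with normalising constant 1. Boundedness is required of the covering
  sets because the library's \<open>diameter\<close> is not meaningful on unbounded sets.\<close>

definition hausdorff_pre :: "real \<Rightarrow> real \<Rightarrow> 'a::metric_space set \<Rightarrow> ennreal" where
  "hausdorff_pre s \<delta> E =
     (INF C\<in>{C :: nat \<Rightarrow> 'a set. E \<subseteq> (\<Union>i. C i) \<and> (\<forall>i. bounded (C i) \<and> diameter (C i) \<le> \<delta>)}.
        \<Sum>i. ennreal (diameter (C i) powr s))"

definition hausdorff_measure :: "real \<Rightarrow> 'a::metric_space set \<Rightarrow> ennreal" where
  "hausdorff_measure s E = (SUP \<delta>\<in>{0<..}. hausdorff_pre s \<delta> E)"

end

theory Submission
  imports Defs "HOL-Complex_Analysis.Complex_Analysis"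
begin

text \<open>
  Let \<open>\<Omega>\<close> be the image of \<open>f\<close> and \<open>E\<close> its complement in the disk. The map \<open>h\<close> is injective on the
  open set \<open>\<Omega>\<close> and maps it onto the disk, so a connected fibre over a point of the open disk cannot
  leave \<open>\<Omega>\<close>: its only point in \<open>\<Omega>\<close> would be isolated in it. Hence \<open>h\<close> maps \<open>E\<close> into the circle. A fibre over a
  point of \<open>Z\<close> is a connected set with at least two points, at most one of which lies on the circle,
  because there \<open>h\<close> agrees with the homeomorphism \<open>h0\<close>; all its other points lie in \<open>E\<close>.

  The holomorphic differential \<open>\<Phi>\<close> forces \<open>E\<close> to be a null set. Indeed \<open>Dh = 0\<close> almost everywhere on
  \<open>E\<close>, so \<open>\<Phi>\<close> vanishes almost everywhere on \<open>E\<close>; if \<open>E\<close> had positive measure, \<open>\<Phi>\<close> would vanish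
  identically. As \<open>A'\<close>, \<open>\<eta>\<close> and the \<open>z\<close>-derivative of \<open>h\<close> do not vanish where \<open>Dh \<noteq> 0\<close>, the
  \<open>z\<close>-bar-derivative of \<open>h\<close> would vanish almost everywhere and \<open>h\<close> would be holomorphic
  (\<open>holomorphic_if_weak_dbar_zero\<close>). But \<open>\<bar>h\<bar>\<close> attains its maximum 1 at the points of \<open>E\<close>, so \<open>h\<close> would
  be constant.

  Now \<open>h\<close> is absolutely continuous on almost every line parallel to an axis, and almost every such
  line meets the null set \<open>E\<close> in a set of length zero; the image under \<open>h\<close> of that intersection then
  has one-dimensional measure zero (\<open>AE_full_line_image_H1_null\<close>). The two coordinates of a
  nondegenerate connected set cannot both be constant, so one of them takes all values of an
  interval. Therefore countably many good lines, chosen with dense coordinates, meet every fibre over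
  a point of \<open>Z\<close> inside \<open>E\<close>, and \<open>Z\<close> is covered by countably many null sets
  (\<open>H1_null_of_nondegenerate_fibres\<close>).

  Both uses of the weak derivatives rest on \<open>rectangle_identity\<close>, a fundamental theorem of calculus
  integrated over a rectangle, which comes from testing with smooth approximations of the indicator
  function of the rectangle.
\<close>

section \<open>Operations on functions of class C k\<close>

text \<open>The class \<open>ck_on\<close> is defined by recursion on directional derivatives, and its closure under
  products needs the inclusion of \<open>C\<^sup>k\<^sup>+\<^sup>1\<close> in \<open>C\<^sup>k\<close>: the product rule also contains undifferentiated
  factors.\<close>

lemma ck_on_SucD: "ck_on (Suc k) U f \<Longrightarrow> ck_on k U f"
proof (induction k arbitrary: f)
  case 0
  then show ?case
    by (simp add: continuous_at_imp_continuous_on differentiable_imp_continuous_within)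
next
  case (Suc k)
  then show ?case by simp
qed

lemma ck_on_const: "ck_on k UNIV (\<lambda>x. c)"
  by (induction k arbitrary: c) auto

lemma ck_on_add:
  assumes "ck_on k UNIV f" "ck_on k UNIV g"
  shows "ck_on k UNIV (\<lambda>x. f x + g x)"
  using assms
proof (induction k arbitrary: f g)
  case 0
  then show ?case by (auto intro: continuous_intros)
next
  case (Suc k)
  have d: "f differentiable (at x)" "g differentiable (at x)" for x
    using Suc.prems by auto
  then have "frechet_derivative (\<lambda>x. f x + g x) (at x) v
      = frechet_derivative f (at x) v + frechet_derivative g (at x) v" for x v
    using frechet_derivative_at[OF has_derivative_add[OF d[THEN frechet_derivative_works[THEN iffD1]]]]
    by (metis (no_types, lifting))
  moreover have "ck_on k UNIV (\<lambda>x. frechet_derivative f (at x) v + frechet_derivative g (at x) v)" for v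
    using Suc.prems by (intro Suc.IH) simp_all
  ultimately show ?case using d by (simp add: differentiable_add)
qed

lemma ck_on_mult:
  fixes f g :: "'a::euclidean_space \<Rightarrow> real"
  assumes "ck_on k UNIV f" "ck_on k UNIV g"
  shows "ck_on k UNIV (\<lambda>x. f x * g x)"
  using assms
proof (induction k arbitrary: f g)
  case 0
  then show ?case by (auto intro: continuous_intros)
next
  case (Suc k)
  have d: "f differentiable (at x)" "g differentiable (at x)" for x
    using Suc.prems by auto
  then have "frechet_derivative (\<lambda>x. f x * g x) (at x) v
      = f x * frechet_derivative g (at x) v + frechet_derivative f (at x) v * g x" for x v
    using frechet_derivative_at[OF has_derivative_mult[OF d[THEN frechet_derivative_works[THEN iffD1]]]]
    by (metis (no_types, lifting))
  moreover have "ck_on k UNIV f" "ck_on k UNIV g"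
    using Suc.prems by (blast dest: ck_on_SucD)+
  then have "ck_on k UNIV (\<lambda>x. f x * frechet_derivative g (at x) v + frechet_derivative f (at x) v * g x)" for v
    using Suc.prems by (intro ck_on_add Suc.IH) simp_all
  ultimately show ?case
    using d by (simp add: differentiable_mult)
qed

lemma ck_on_affine:
  assumes "ck_on k UNIV f" "\<And>x. (L has_derivative L') (at x)"
  shows "ck_on k UNIV (\<lambda>x. f (L x))"
  using assms(1)
proof (induction k arbitrary: f)
  case 0
  have "continuous_on UNIV L"
    by (intro continuous_at_imp_continuous_on ballI has_derivative_continuous[OF assms(2)])
  with 0 show ?case
    by (metis ck_on.simps(1) continuous_on_compose2 subset_UNIV)
next
  case (Suc k)
  have d: "((\<lambda>x. f (L x)) has_derivative (\<lambda>v. frechet_derivative f (at (L x)) (L' v))) (at x)" for x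
    using Suc.prems by (intro has_derivative_compose[OF assms(2)]) (auto simp: frechet_derivative_works[symmetric])
  then have "frechet_derivative (\<lambda>x. f (L x)) (at x) v = frechet_derivative f (at (L x)) (L' v)" for x v
    using frechet_derivative_at by metis
  moreover have "ck_on k UNIV (\<lambda>x. frechet_derivative f (at (L x)) (L' v))" for v
    using Suc.prems by (intro Suc.IH) simp
  moreover have "(\<lambda>x. f (L x)) differentiable (at x)" for x
    using d by (rule differentiableI)
  ultimately show ?case by simp
qed

lemma ck_on_real_SucI:
  fixes f :: "real \<Rightarrow> real"
  assumes "\<And>x. (f has_real_derivative f' x) (at x)" "ck_on k UNIV f'"
  shows "ck_on (Suc k) UNIV f"
proof -
  have "frechet_derivative f (at x) v = f' x * v" for x v
    using frechet_derivative_at[OF assms(1)[of x, unfolded has_field_derivative_def]] by metis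
  moreover have "f differentiable (at x)" for x
    using assms(1) real_differentiable_def by blast
  ultimately show ?thesis
    using assms(2) by (simp add: ck_on_mult ck_on_const)
qed

section \<open>A smooth step function\<close>

text \<open>These are the functions through which all derivatives of \<open>exp (-1/x)\<close> run: the family is closed
  under differentiation, which gives smoothness by a plain induction.\<close>

definition flat :: "real poly \<Rightarrow> real \<Rightarrow> real" where
  "flat p x = (if x \<le> 0 then 0 else poly p (1 / x) * exp (- (1 / x)))"

text \<open>Read at \<open>t = 1/x\<close>, this decay makes every difference quotient at the origin tend to 0.\<close>

lemma poly_times_exp_minus_tendsto_0: "((\<lambda>t::real. poly p t * exp (- t)) \<longlongrightarrow> 0) at_top"
proof -
  have "((\<lambda>t. \<Sum>i\<le>degree p. coeff p i * (t ^ i / exp t)) \<longlongrightarrow> (\<Sum>i\<le>degree p. coeff p i * 0)) at_top"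
    by (intro tendsto_sum tendsto_mult tendsto_const tendsto_power_div_exp_0)
  then show ?thesis
    by (simp add: poly_altdef exp_minus divide_inverse sum_distrib_right mult.assoc)
qed

lemma flat_has_derivative:
  "(flat p has_real_derivative flat ([:0, 0, 1:] * (p - pderiv p)) x) (at x)"
proof (cases "x = 0")
  case False
  then consider "x < 0" | "x > 0" by linarith
  then show ?thesis
  proof cases
    case 1
    show ?thesis
      by (rule has_field_derivative_transform_within_open[where f = "\<lambda>_. 0" and S = "{..<0}"])
         (use 1 in \<open>auto simp: flat_def\<close>)
  next
    case 2
    have inv: "((\<lambda>x. 1 / x) has_real_derivative - (1 / x * (1 / x))) (at x)"
      using 2 DERIV_inverse[of x UNIV] by (simp add: inverse_eq_divide power2_eq_square)
    have "((\<lambda>x. poly p (1 / x) * exp (- (1 / x))) has_real_derivative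
        poly (pderiv p) (1 / x) * - (1 / x * (1 / x)) * exp (- (1 / x)) +
        exp (- (1 / x)) * (- (- (1 / x * (1 / x)))) * poly p (1 / x)) (at x)"
      by (intro DERIV_mult DERIV_chain2[OF poly_DERIV inv] DERIV_chain2[OF DERIV_exp DERIV_minus[OF inv]])
    also have "poly (pderiv p) (1 / x) * - (1 / x * (1 / x)) * exp (- (1 / x)) +
        exp (- (1 / x)) * (- (- (1 / x * (1 / x)))) * poly p (1 / x)
        = flat ([:0, 0, 1:] * (p - pderiv p)) x"
      using 2 by (simp add: flat_def algebra_simps)
    finally have "((\<lambda>x. poly p (1 / x) * exp (- (1 / x))) has_real_derivative
        flat ([:0, 0, 1:] * (p - pderiv p)) x) (at x)" .
    then show ?thesis
      by (rule has_field_derivative_transform_within_open[where S = "{0<..}"])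
         (use 2 in \<open>auto simp: flat_def\<close>)
  qed
next
  case True
  have "((\<lambda>y. flat p y / y) \<longlongrightarrow> 0) (at 0)"
  proof (rule filterlim_split_at)
    show "((\<lambda>y. flat p y / y) \<longlongrightarrow> 0) (at_left 0)"
      by (rule tendsto_eventually) (auto simp: flat_def eventually_at_filter)
    have "((\<lambda>y. poly ([:0, 1:] * p) (inverse y) * exp (- inverse y)) \<longlongrightarrow> 0) (at_right 0)"
      by (rule filterlim_compose[OF poly_times_exp_minus_tendsto_0 filterlim_inverse_at_top_right])
    then show "((\<lambda>y. flat p y / y) \<longlongrightarrow> 0) (at_right 0)"
      by (rule Lim_transform_eventually)
         (auto simp: flat_def eventually_at_filter divide_inverse)
  qed
  then show ?thesis
    using True by (simp add: DERIV_def flat_def)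
qed

lemma ck_on_flat: "ck_on k UNIV (flat p)"
proof (induction k arbitrary: p)
  case 0
  then show ?case
    using flat_has_derivative DERIV_isCont continuous_at_imp_continuous_on by (metis ck_on.simps(1))
next
  case (Suc k)
  show ?case by (rule ck_on_real_SucI[OF flat_has_derivative Suc])
qed

text \<open>The two summands of the denominator never vanish together, so the quotient is smooth; it rises
  from 0 on the negative half-line to 1 beyond 1.\<close>

definition smooth_step :: "real \<Rightarrow> real" where
  "smooth_step x = flat 1 x * inverse (flat 1 x + flat 1 (1 - x))"

lemma flat_1_nonneg: "flat 1 x \<ge> 0"
  and flat_1_pos: "x > 0 \<Longrightarrow> flat 1 x > 0"
  by (auto simp: flat_def)

lemma flat_sum_pos: "flat 1 x + flat 1 (1 - x) > 0"
  using flat_1_nonneg[of x] flat_1_pos[of x] flat_1_nonneg[of "1 - x"] flat_1_pos[of "1 - x"]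
  by (cases "x > 0") auto

lemma smooth_step_eq_0: "x \<le> 0 \<Longrightarrow> smooth_step x = 0"
  by (simp add: smooth_step_def flat_def)

lemma smooth_step_eq_1: "x \<ge> 1 \<Longrightarrow> smooth_step x = 1"
  using flat_1_pos[of x] by (simp add: smooth_step_def flat_def)

lemma smooth_step_bounds: "0 \<le> smooth_step x" "smooth_step x \<le> 1"
  using flat_1_nonneg[of x] flat_1_nonneg[of "1 - x"] flat_sum_pos[of x]
  by (auto simp: smooth_step_def field_simps)

lemma ck_on_inverse:
  fixes f :: "real \<Rightarrow> real"
  assumes "\<And>k. ck_on k UNIV f" "\<And>x. f x \<noteq> 0"
  shows "ck_on k UNIV (\<lambda>x. inverse (f x))"
proof (induction k)
  case 0
  then show ?case using assms(1)[of 0] assms(2) by (auto intro: continuous_intros)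
next
  case (Suc k)
  have "\<forall>x. f differentiable (at x)" using assms(1)[of 1] by simp
  then have D: "(f has_real_derivative deriv f x) (at x)" for x
    by (simp add: DERIV_deriv_iff_real_differentiable)
  then have fr: "frechet_derivative f (at x) v = deriv f x * v" for x v
    using frechet_derivative_at[OF D[of x, unfolded has_field_derivative_def]] by metis
  have "ck_on k UNIV (\<lambda>x. frechet_derivative f (at x) 1)"
    using assms(1)[of "Suc k"] by simp
  then have "ck_on k UNIV (deriv f)" by (simp add: fr)
  then have "ck_on k UNIV (\<lambda>x. -1 * (inverse (f x) * deriv f x * inverse (f x)))"
    by (intro ck_on_mult ck_on_const Suc)
  moreover have "((\<lambda>x. inverse (f x)) has_real_derivative
      -1 * (inverse (f x) * deriv f x * inverse (f x))) (at x)" for x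
    using DERIV_inverse'[OF D assms(2)] by simp
  ultimately show ?case by (rule ck_on_real_SucI[rotated])
qed

lemma ck_on_smooth_step: "ck_on k UNIV smooth_step"
proof -
  have "((\<lambda>x::real. 1 - x) has_derivative uminus) (at x)" for x
    by (auto intro!: derivative_eq_intros)
  from ck_on_affine[OF ck_on_flat this] show ?thesis
    unfolding smooth_step_def [abs_def]
    by (intro ck_on_mult ck_on_flat ck_on_inverse ck_on_add less_imp_neq[OF flat_sum_pos, symmetric])
qed

lemma smooth_step_has_derivative:
  "(smooth_step has_real_derivative deriv smooth_step x) (at x)"
  using ck_on_smooth_step[of 1] by (simp add: DERIV_deriv_iff_real_differentiable)

lemma continuous_deriv_smooth_step: "continuous_on UNIV (deriv smooth_step)"
proof -
  have "continuous_on UNIV (\<lambda>x. frechet_derivative smooth_step (at x) 1)"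
    using ck_on_smooth_step[of 1] by simp
  moreover have "frechet_derivative smooth_step (at x) 1 = deriv smooth_step x" for x
    using frechet_derivative_at[OF smooth_step_has_derivative[of x, unfolded has_field_derivative_def]]
    by (metis mult_1_right)
  ultimately show ?thesis by simp
qed

lemma deriv_smooth_step_eq_0:
  assumes "x \<notin> {0..1}" shows "deriv smooth_step x = 0"
proof -
  consider "x < 0" | "x > 1" using assms by force
  then show ?thesis
  proof cases
    case 1
    have "(smooth_step has_real_derivative 0) (at x)"
      by (rule has_field_derivative_transform_within_open[where f = "\<lambda>_. 0" and S = "{..<0}"])
         (use 1 in \<open>auto simp: smooth_step_eq_0\<close>)
    then show ?thesis by (rule DERIV_imp_deriv)
  next
    case 2
    have "(smooth_step has_real_derivative 0) (at x)"
      by (rule has_field_derivative_transform_within_open[where f = "\<lambda>_. 1" and S = "{1<..}"])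
         (use 2 in \<open>auto simp: smooth_step_eq_1\<close>)
    then show ?thesis by (rule DERIV_imp_deriv)
  qed
qed

lemma deriv_smooth_step_bounded:
  obtains M where "M > 0" "\<And>x. \<bar>deriv smooth_step x\<bar> \<le> M"
proof -
  have "compact (deriv smooth_step ` {0..1})"
    by (intro compact_continuous_image continuous_on_subset[OF continuous_deriv_smooth_step]) auto
  then obtain B where B: "B > 0" "\<And>x. x \<in> {0..1} \<Longrightarrow> \<bar>deriv smooth_step x\<bar> \<le> B"
    by (metis bounded_pos compact_imp_bounded image_eqI real_norm_def)
  have "\<bar>deriv smooth_step x\<bar> \<le> B" for x
    using B deriv_smooth_step_eq_0[of x] by (cases "x \<in> {0..1}") auto
  with B(1) that show ?thesis by blast
qed

section \<open>Approximate indicator functions of intervals\<close>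

text \<open>A difference of two rescaled steps of width \<open>1 / n\<close>. The shift by 1 in the second one keeps the
  support inside \<open>{a..b}\<close> as soon as \<open>1 / n \<le> b - a\<close>, so that a test function for an open set can
  be supported in any compact rectangle of that set.\<close>

definition plateau :: "real \<Rightarrow> real \<Rightarrow> nat \<Rightarrow> real \<Rightarrow> real" where
  "plateau a b n x = smooth_step (n * (x - a)) - smooth_step (n * (x - b) + 1)"

text \<open>The derivative of a rescaled step: an approximate point mass at \<open>a\<close>, supported in
  \<open>{a..a + 1 / n}\<close>.\<close>

definition spike :: "real \<Rightarrow> nat \<Rightarrow> real \<Rightarrow> real" where
  "spike a n x = n * deriv smooth_step (n * (x - a))"

lemma smooth_step_scaled_has_derivative:
  "((\<lambda>x. smooth_step (n * (x - a))) has_real_derivative spike a n x) (at x)"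
  unfolding spike_def
  by (rule DERIV_cong[OF DERIV_chain2[OF smooth_step_has_derivative]])
     (auto intro!: derivative_eq_intros)

lemma plateau_eq:
  assumes "n > 0"
  shows "plateau a b n x = smooth_step (n * (x - a)) - smooth_step (n * (x - (b - 1 / n)))"
  using assms by (simp add: plateau_def algebra_simps)

lemma plateau_has_derivative:
  assumes "n > 0"
  shows "(plateau a b n has_real_derivative spike a n x - spike (b - 1 / n) n x) (at x)"
  unfolding plateau_eq[OF assms, abs_def]
  by (intro DERIV_diff smooth_step_scaled_has_derivative)

lemma continuous_spike: "continuous_on S (spike a n)"
  unfolding spike_def
  by (intro continuous_intros continuous_on_compose2[OF continuous_deriv_smooth_step]) auto

lemma ck_on_plateau: "ck_on k UNIV (plateau a b n)"
proof -
  have 1: "((\<lambda>x. real n * (x - a)) has_derivative (\<lambda>v. n * v)) (at x)" for x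
    by (auto intro!: derivative_eq_intros)
  have 2: "((\<lambda>x. real n * (x - b) + 1) has_derivative (\<lambda>v. n * v)) (at x)" for x
    by (auto intro!: derivative_eq_intros)
  have "ck_on k UNIV (\<lambda>x. smooth_step (n * (x - a)) + -1 * smooth_step (n * (x - b) + 1))"
    by (intro ck_on_add ck_on_mult ck_on_const ck_on_affine[OF ck_on_smooth_step 1]
        ck_on_affine[OF ck_on_smooth_step 2])
  then show ?thesis by (simp add: plateau_def[abs_def])
qed

lemma continuous_plateau: "continuous_on S (plateau a b n)"
  using ck_on_plateau[of 0] by (auto intro: continuous_on_subset)

lemma plateau_abs_le: "\<bar>plateau a b n x\<bar> \<le> 1"
  using smooth_step_bounds[of "n * (x - a)"] smooth_step_bounds[of "n * (x - b) + 1"]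
  unfolding plateau_def by linarith

lemma plateau_eq_0:
  assumes "1 \<le> n * (b - a)" "x \<notin> {a..b}"
  shows "plateau a b n x = 0"
proof -
  consider "x < a" | "x > b" using assms by fastforce
  then show ?thesis
  proof cases
    case 1
    then have "n * (x - a) \<le> 0" by (simp add: mult_nonneg_nonpos)
    moreover have "n * (x - b) = n * (x - a) - n * (b - a)" by (simp add: algebra_simps)
    ultimately show ?thesis using assms by (simp add: plateau_def smooth_step_eq_0)
  next
    case 2
    then have "n * (x - b) \<ge> 0" by simp
    moreover have "n * (x - a) = n * (x - b) + n * (b - a)" by (simp add: algebra_simps)
    ultimately show ?thesis using assms by (simp add: plateau_def smooth_step_eq_1)
  qed
qed

lemma plateau_tendsto_1:
  assumes "a < x" "x < b"
  shows "(\<lambda>n. plateau a b n x) \<longlonglongrightarrow> 1"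
proof -
  obtain n1 where n1: "1 < real n1 * (x - a)"
    using reals_Archimedean3[of "x - a"] assms by auto
  obtain n2 where n2: "1 < real n2 * (b - x)"
    using reals_Archimedean3[of "b - x"] assms by auto
  have "plateau a b n x = 1" if "n \<ge> n1 + n2" for n
  proof -
    have "real n1 * (x - a) \<le> n * (x - a)" "real n2 * (b - x) \<le> n * (b - x)"
      using that assms by (auto intro!: mult_right_mono)
    with n1 n2 have "n * (x - a) \<ge> 1" "n * (x - b) + 1 \<le> 0"
      by (auto simp: algebra_simps)
    then show ?thesis by (simp add: plateau_def smooth_step_eq_1 smooth_step_eq_0)
  qed
  then show ?thesis
    by (intro tendsto_eventually eventually_sequentiallyI[of "n1 + n2"])
qed

lemma spike_eq_0:
  assumes "n > 0" "x \<notin> {a..a + 1 / n}"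
  shows "spike a n x = 0"
proof -
  have "n * (x - a) \<notin> {0..1}"
    using assms by (auto simp: field_simps zero_le_mult_iff)
  then show ?thesis by (simp add: spike_def deriv_smooth_step_eq_0)
qed

lemma spike_has_integral:
  assumes "n > 0"
  shows "(spike a n has_integral 1) {a..a + 1 / n}"
proof -
  have "(spike a n has_integral smooth_step (n * (a + 1 / n - a)) - smooth_step (n * (a - a))) {a..a + 1 / n}"
    using assms smooth_step_scaled_has_derivative
    by (intro fundamental_theorem_of_calculus)
       (auto simp: has_real_derivative_iff_has_vector_derivative[symmetric]
             intro: has_field_derivative_at_within)
  then show ?thesis using assms by (simp add: smooth_step_eq_0 smooth_step_eq_1)
qed

text \<open>The spike has integral 1 and is bounded by \<open>n * M\<close> on an interval of length \<open>1 / n\<close>. Taking \<open>l = 0\<close>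
  turns the estimate into the uniform bound needed for dominated convergence.\<close>

lemma spike_integral_approx:
  fixes u :: "real \<Rightarrow> 'a::euclidean_space"
  assumes M: "\<And>x. \<bar>deriv smooth_step x\<bar> \<le> M" and "n > 0"
    and u: "continuous_on {a..a + 1 / n} u"
    and close: "\<And>s. s \<in> {a..a + 1 / n} \<Longrightarrow> norm (u s - l) \<le> e"
  shows "norm (integral {a..a + 1 / n} (\<lambda>s. spike a n s *\<^sub>R u s) - l) \<le> M * e"
proof -
  have "(\<lambda>s. spike a n s *\<^sub>R u s) integrable_on {a..a + 1 / n}"
    by (intro integrable_continuous_interval continuous_intros continuous_spike u)
  then have "((\<lambda>s. spike a n s *\<^sub>R u s - spike a n s *\<^sub>R l) has_integral
      integral {a..a + 1 / n} (\<lambda>s. spike a n s *\<^sub>R u s) - 1 *\<^sub>R l) {a..a + 1 / n}"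
    by (intro has_integral_diff integrable_integral has_integral_scaleR_left spike_has_integral assms)
  then have *: "((\<lambda>s. spike a n s *\<^sub>R (u s - l)) has_integral
      integral {a..a + 1 / n} (\<lambda>s. spike a n s *\<^sub>R u s) - l) (cbox a (a + 1 / n))"
    by (simp add: scaleR_diff_right)
  have "norm (spike a n s *\<^sub>R (u s - l)) \<le> n * M * e" if "s \<in> cbox a (a + 1 / n)" for s
  proof -
    have "\<bar>spike a n s\<bar> \<le> n * M" using M by (simp add: spike_def abs_mult mult_left_mono)
    then show ?thesis using close that by (auto intro!: mult_mono)
  qed
  moreover have "0 \<le> n * M * e"
    using order_trans[OF abs_ge_zero M] order_trans[OF norm_ge_zero close[of a]]
    by (intro mult_nonneg_nonneg) auto
  ultimately have "norm (integral {a..a + 1 / n} (\<lambda>s. spike a n s *\<^sub>R u s) - l)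
      \<le> n * M * e * measure lborel (cbox a (a + 1 / n))"
    using has_integral_bound[OF _ *] by blast
  also have "\<dots> = M * e" using \<open>n > 0\<close> by simp
  finally show ?thesis .
qed

text \<open>The base point \<open>x n\<close> of the spike may move: the spike at the right end of an interval starts
  \<open>1 / n\<close> before it.\<close>

lemma spike_integral_tendsto:
  fixes u :: "real \<Rightarrow> 'a::euclidean_space"
  assumes u: "continuous_on {a..b} u" and e: "e \<in> {a..b}"
    and x: "\<And>n. n \<ge> N \<Longrightarrow> a \<le> x n \<and> x n + 1 / real n \<le> b \<and> \<bar>x n - e\<bar> \<le> 1 / n"
  shows "(\<lambda>n. integral {x n..x n + 1 / real n} (\<lambda>s. spike (x n) n s *\<^sub>R u s)) \<longlonglongrightarrow> u e"
proof (rule LIMSEQ_I)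
  fix r :: real assume "r > 0"
  obtain M where M: "M > 0" "\<And>x. \<bar>deriv smooth_step x\<bar> \<le> M"
    using deriv_smooth_step_bounded by blast
  define r' where "r' = r / (2 * M)"
  have "r' > 0" using \<open>r > 0\<close> M by (simp add: r'_def)
  then obtain d where d: "d > 0" "\<And>s. s \<in> {a..b} \<Longrightarrow> dist s e < d \<Longrightarrow> dist (u s) (u e) < r'"
    using u e unfolding continuous_on_iff by metis
  obtain k where k: "2 / d < real k" using reals_Archimedean2 by blast
  show "\<exists>no. \<forall>n\<ge>no. norm (integral {x n..x n + 1 / real n} (\<lambda>s. spike (x n) n s *\<^sub>R u s) - u e) < r"
  proof (intro exI allI impI)
    fix n assume n: "n \<ge> N + k + 1"
    then have "2 / d < n" using k by linarith
    then have n2: "2 / real n < d" using d(1) n by (simp add: field_simps)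
    have sub: "{x n..x n + 1 / real n} \<subseteq> {a..b}" using x[of n] n by auto
    have "norm (u s - u e) \<le> r'" if "s \<in> {x n..x n + 1 / real n}" for s
    proof -
      have "dist s e \<le> 2 / n"
        using that x[of n] n by (auto simp: dist_real_def)
      then show ?thesis using d(2)[of s] that sub n2 by (fastforce simp: dist_norm)
    qed
    then have "norm (integral {x n..x n + 1 / real n} (\<lambda>s. spike (x n) n s *\<^sub>R u s) - u e) \<le> M * r'"
      using n by (intro spike_integral_approx M continuous_on_subset[OF u sub]) auto
    also have "\<dots> < r" using \<open>r > 0\<close> M by (simp add: r'_def)
    finally show "norm (integral {x n..x n + 1 / real n} (\<lambda>s. spike (x n) n s *\<^sub>R u s) - u e) < r" .
  qed
qed

lemma spike_integral_extend:
  fixes u :: "real \<Rightarrow> 'a::euclidean_space"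
  assumes "n > 0" "{x..x + 1 / real n} \<subseteq> {a..b}" "continuous_on {a..b} u"
  shows "((\<lambda>s. spike x n s *\<^sub>R u s) has_integral
    integral {x..x + 1 / n} (\<lambda>s. spike x n s *\<^sub>R u s)) {a..b}"
  using assms
  by (intro has_integral_on_superset[OF integrable_integral] integrable_continuous_interval
      continuous_intros continuous_spike) (auto simp: spike_eq_0 intro: continuous_on_subset)

text \<open>The derivative of the plateau consists of two spikes of opposite sign, one at each end, which in
  the limit become point evaluations; the bound holds uniformly in \<open>n\<close>.\<close>

lemma plateau_deriv_integral:
  fixes u :: "real \<Rightarrow> 'a::euclidean_space"
  assumes "a < b" and u: "continuous_on {a..b} u"
  defines "I \<equiv> \<lambda>n. integral {a..b} (\<lambda>s. (spike a n s - spike (b - 1 / n) n s) *\<^sub>R u s)"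
  shows "I \<longlonglongrightarrow> u a - u b"
    and "\<lbrakk>\<And>x. \<bar>deriv smooth_step x\<bar> \<le> M; \<And>s. s \<in> {a..b} \<Longrightarrow> norm (u s) \<le> B; n > 0; 1 \<le> n * (b - a)\<rbrakk>
      \<Longrightarrow> norm (I n) \<le> 2 * M * B"
proof -
  have I: "I n = integral {a..a + 1 / n} (\<lambda>s. spike a n s *\<^sub>R u s)
      - integral {b - 1 / n..b - 1 / n + 1 / n} (\<lambda>s. spike (b - 1 / n) n s *\<^sub>R u s)"
    if n: "n > 0" "1 \<le> n * (b - a)" for n :: nat
  proof -
    have "1 / n \<le> b - a" using n by (simp add: field_simps)
    then have "{a..a + 1 / n} \<subseteq> {a..b}" "{b - 1 / n..b - 1 / n + 1 / n} \<subseteq> {a..b}" using n by auto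
    from has_integral_diff[OF spike_integral_extend[OF n(1) this(1) u] spike_integral_extend[OF n(1) this(2) u]]
    show ?thesis unfolding I_def scaleR_diff_left by (rule integral_unique)
  qed
  obtain N where N: "1 < real N * (b - a)"
    using reals_Archimedean3[of "b - a"] \<open>a < b\<close> by auto
  have big: "n > 0 \<and> 1 \<le> n * (b - a)" if "n \<ge> N + 1" for n :: nat
  proof -
    have "real N * (b - a) \<le> n * (b - a)" using that \<open>a < b\<close> by (intro mult_right_mono) auto
    then show ?thesis using N that by auto
  qed
  have "1 / real n \<le> b - a" if "n \<ge> N + 1" for n
    using big[OF that] by (auto simp: field_simps)
  then have "(\<lambda>n. integral {a..a + 1 / n} (\<lambda>s. spike a n s *\<^sub>R u s)
      - integral {b - 1 / n..b - 1 / n + 1 / n} (\<lambda>s. spike (b - 1 / n) n s *\<^sub>R u s)) \<longlonglongrightarrow> u a - u b"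
    using \<open>a < b\<close> by (intro tendsto_diff spike_integral_tendsto[OF u, where N = "N + 1"]) fastforce+
  then show "I \<longlonglongrightarrow> u a - u b"
    by (rule Lim_transform_eventually) (use big I in \<open>auto intro!: eventually_sequentiallyI[of "N + 1"]\<close>)
  show "norm (I n) \<le> 2 * M * B"
    if M: "\<And>x. \<bar>deriv smooth_step x\<bar> \<le> M" and B: "\<And>s. s \<in> {a..b} \<Longrightarrow> norm (u s) \<le> B"
      and n: "n > 0" "1 \<le> n * (b - a)"
  proof -
    have "1 / n \<le> b - a" using n by (simp add: field_simps)
    then have sub: "{a..a + 1 / n} \<subseteq> {a..b}" "{b - 1 / n..b - 1 / n + 1 / n} \<subseteq> {a..b}" using n by auto
    have "norm (integral {a..a + 1 / n} (\<lambda>s. spike a n s *\<^sub>R u s) - 0) \<le> M * B"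
      "norm (integral {b - 1 / n..b - 1 / n + 1 / n} (\<lambda>s. spike (b - 1 / n) n s *\<^sub>R u s) - 0) \<le> M * B"
      using B sub n by (intro spike_integral_approx M continuous_on_subset[OF u]; force)+
    then show ?thesis
      unfolding I[OF n] by (intro norm_triangle_le_diff) simp
  qed
qed

section \<open>Coordinates along an axis direction\<close>

text \<open>Horizontal and vertical lines are treated together: for \<open>v = 1\<close> the transversal direction
  \<open>\<i> * cnj v\<close> is \<open>\<i>\<close>, and for \<open>v = \<i>\<close> it is 1. The first coordinate \<open>s\<close> runs along \<open>v\<close>.\<close>

definition pt :: "complex \<Rightarrow> real \<Rightarrow> real \<Rightarrow> complex" where
  "pt v s t = of_real s * v + of_real t * (\<i> * cnj v)"

definition rect :: "complex \<Rightarrow> real \<Rightarrow> real \<Rightarrow> real \<Rightarrow> real \<Rightarrow> complex set" where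
  "rect v a b c d = {w. w \<bullet> v \<in> {a..b} \<and> w \<bullet> (\<i> * cnj v) \<in> {c..d}}"

lemma frame_simps:
  assumes "v \<in> {1, \<i>}"
  shows "pt v s t \<bullet> v = s" "pt v s t \<bullet> (\<i> * cnj v) = t"
    "pt v (w \<bullet> v) (w \<bullet> (\<i> * cnj v)) = w" "v \<bullet> v = 1" "v \<bullet> (\<i> * cnj v) = 0"
    "v \<in> Basis" "\<i> * cnj v \<in> Basis"
  using assms by (auto simp: pt_def complex_eq_iff inner_complex_def Basis_complex_def)

lemma continuous_pt [continuous_intros]:
  "continuous_on S f \<Longrightarrow> continuous_on S g \<Longrightarrow> continuous_on S (\<lambda>x. pt v (f x) (g x))"
  unfolding pt_def by (intro continuous_intros)

lemma rect_eq_image: "v \<in> {1, \<i>} \<Longrightarrow> rect v a b c d = (\<lambda>p. pt v (fst p) (snd p)) ` ({a..b} \<times> {c..d})"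
proof (intro equalityI subsetI)
  fix w assume v: "v \<in> {1, \<i>}" and "w \<in> rect v a b c d"
  then show "w \<in> (\<lambda>p. pt v (fst p) (snd p)) ` ({a..b} \<times> {c..d})"
    by (intro image_eqI[of _ _ "(w \<bullet> v, w \<bullet> (\<i> * cnj v))"]) (simp_all add: rect_def frame_simps(3)[OF v])
next
  fix w assume v: "v \<in> {1, \<i>}" and w: "w \<in> (\<lambda>p. pt v (fst p) (snd p)) ` ({a..b} \<times> {c..d})"
  show "w \<in> rect v a b c d"
    using w unfolding rect_def by (auto simp: frame_simps[OF v])
qed

lemma pt_in_rect: "v \<in> {1, \<i>} \<Longrightarrow> pt v s t \<in> rect v a b c d \<longleftrightarrow> s \<in> {a..b} \<and> t \<in> {c..d}"
  unfolding rect_def by (simp only: mem_Collect_eq frame_simps)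

lemma compact_rect: "v \<in> {1, \<i>} \<Longrightarrow> compact (rect v a b c d)"
  unfolding rect_eq_image
  by (intro compact_continuous_image compact_Times continuous_intros) auto

lemma borel_rect [measurable]: "v \<in> {1, \<i>} \<Longrightarrow> rect v a b c d \<in> sets borel"
  using compact_rect by (blast intro: borel_compact)

lemma pt_measurable [measurable]:
  "(\<lambda>(s, t). pt v s t) \<in> borel \<Otimes>\<^sub>M borel \<rightarrow>\<^sub>M borel"
  unfolding pt_def by measurable

lemma lborel_distr_pt:
  assumes v: "v \<in> {1, \<i>}"
  shows "distr (lborel \<Otimes>\<^sub>M lborel) borel (\<lambda>(s, t). pt v s t) = lborel"
proof (rule lborel_eqI[symmetric])
  fix l u :: complex
  assume lu: "\<And>b. b \<in> Basis \<Longrightarrow> l \<bullet> b \<le> u \<bullet> b"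
  let ?v = "\<i> * cnj v"
  have le: "l \<bullet> v \<le> u \<bullet> v" "l \<bullet> ?v \<le> u \<bullet> ?v"
    using lu frame_simps[OF v] by blast+
  have B: "Basis = {v, ?v}" "v \<noteq> ?v"
    using v by (auto simp: Basis_complex_def)
  have "(\<lambda>(s, t). pt v s t) -` box l u \<inter> space (lborel \<Otimes>\<^sub>M lborel)
      = {l \<bullet> v<..<u \<bullet> v} \<times> {l \<bullet> ?v<..<u \<bullet> ?v}"
    by (auto simp: box_def B frame_simps[OF v] space_pair_measure)
  then have "emeasure (distr (lborel \<Otimes>\<^sub>M lborel) borel (\<lambda>(s, t). pt v s t)) (box l u)
      = emeasure (lborel \<Otimes>\<^sub>M lborel) ({l \<bullet> v<..<u \<bullet> v} \<times> {l \<bullet> ?v<..<u \<bullet> ?v})"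
    by (subst emeasure_distr) auto
  also have "\<dots> = ennreal (u \<bullet> v - l \<bullet> v) * ennreal (u \<bullet> ?v - l \<bullet> ?v)"
    using le by (subst lborel.emeasure_pair_measure_Times) auto
  also have "\<dots> = (\<Prod>b\<in>Basis. (u - l) \<bullet> b)"
    using le B(2) by (simp add: B(1) ennreal_mult[symmetric] inner_diff_left)
  finally show "emeasure (distr (lborel \<Otimes>\<^sub>M lborel) borel (\<lambda>(s, t). pt v s t)) (box l u)
      = (\<Prod>b\<in>Basis. (u - l) \<bullet> b)" .
qed simp

lemma fubini_pt:
  fixes F :: "complex \<Rightarrow> 'a::{banach, second_countable_topology}"
  assumes v: "v \<in> {1, \<i>}" and F: "integrable lborel F"
  shows "AE t in lborel. integrable lborel (\<lambda>s. F (pt v s t))"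
    and "integrable lborel (\<lambda>t. \<integral>s. F (pt v s t) \<partial>lborel)"
    and "(\<integral>w. F w \<partial>lborel) = (\<integral>t. (\<integral>s. F (pt v s t) \<partial>lborel) \<partial>lborel)"
proof -
  have m: "F \<in> borel_measurable borel" using F by auto
  have [simp]: "(\<lambda>x. F (case x of (s, t) \<Rightarrow> pt v s t)) = (\<lambda>(s, t). F (pt v s t))"
    by auto
  have "integrable (distr (lborel \<Otimes>\<^sub>M lborel) borel (\<lambda>(s, t). pt v s t)) F"
    using F by (simp add: lborel_distr_pt[OF v])
  then have i: "integrable (lborel \<Otimes>\<^sub>M lborel) (\<lambda>(s, t). F (pt v s t))"
    using m by (subst (asm) integrable_distr_eq) (auto simp: case_prod_unfold)
  show "AE t in lborel. integrable lborel (\<lambda>s. F (pt v s t))"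
    and "integrable lborel (\<lambda>t. \<integral>s. F (pt v s t) \<partial>lborel)"
    using lborel_pair.AE_integrable_snd[OF i] lborel_pair.integrable_snd[OF i] by auto
  have "(\<integral>w. F w \<partial>lborel) = (\<integral>w. F w \<partial>distr (lborel \<Otimes>\<^sub>M lborel) borel (\<lambda>(s, t). pt v s t))"
    by (simp add: lborel_distr_pt[OF v])
  also have "\<dots> = (\<integral>x. (\<lambda>(s, t). F (pt v s t)) x \<partial>(lborel \<Otimes>\<^sub>M lborel))"
    using m by (subst integral_distr) (auto simp: case_prod_unfold)
  also have "\<dots> = (\<integral>t. (\<integral>s. F (pt v s t) \<partial>lborel) \<partial>lborel)"
    using lborel_pair.integral_snd[OF i] by simp
  finally show "(\<integral>w. F w \<partial>lborel) = (\<integral>t. (\<integral>s. F (pt v s t) \<partial>lborel) \<partial>lborel)" .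
qed

section \<open>The rectangle identity for weak derivatives\<close>

definition bump :: "complex \<Rightarrow> real \<Rightarrow> real \<Rightarrow> real \<Rightarrow> real \<Rightarrow> nat \<Rightarrow> complex \<Rightarrow> real" where
  "bump v a b c d n w = plateau a b n (w \<bullet> v) * plateau c d n (w \<bullet> (\<i> * cnj v))"

lemma bump_eq_0:
  assumes "1 \<le> n * (b - a)" "1 \<le> n * (d - c)" "w \<notin> rect v a b c d"
  shows "bump v a b c d n w = 0"
  using assms plateau_eq_0[of n b a "w \<bullet> v"] plateau_eq_0[of n d c "w \<bullet> (\<i> * cnj v)"]
  unfolding rect_def bump_def by auto

lemma test_function_bump:
  assumes "v \<in> {1, \<i>}" "1 \<le> n * (b - a)" "1 \<le> n * (d - c)" "rect v a b c d \<subseteq> U"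
  shows "test_function U (bump v a b c d n)"
proof -
  have "((\<lambda>x. x \<bullet> u) has_derivative (\<lambda>x. x \<bullet> u)) (at x)" for x u :: complex
    by (intro derivative_intros)
  from ck_on_affine[OF ck_on_plateau this]
  have "smooth_on UNIV (bump v a b c d n)"
    unfolding bump_def[abs_def] smooth_on_def by (intro allI ck_on_mult)
  then show ?thesis
    using assms bump_eq_0 compact_rect unfolding test_function_def by metis
qed

lemma frechet_derivative_bump:
  assumes v: "v \<in> {1, \<i>}" and "n > 0"
  shows "frechet_derivative (bump v a b c d n) (at w) v =
    (spike a n (w \<bullet> v) - spike (b - 1 / n) n (w \<bullet> v)) * plateau c d n (w \<bullet> (\<i> * cnj v))"
proof -
  have D: "((\<lambda>x. plateau a b n (x \<bullet> u)) has_derivative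
      (\<lambda>y. (spike a n (w \<bullet> u) - spike (b - 1 / n) n (w \<bullet> u)) * (y \<bullet> u))) (at w)" for a b u
    by (rule has_derivative_compose[OF _ plateau_has_derivative[OF \<open>n > 0\<close>, unfolded has_field_derivative_def]])
       (intro derivative_intros)
  from frechet_derivative_at[OF has_derivative_mult[OF D[of a b v] D[of c d "\<i> * cnj v"]], symmetric]
  show ?thesis
    by (simp add: bump_def[abs_def] frame_simps[OF v])
qed

lemma eventually_reciprocal_small: "(a::real) < b \<Longrightarrow> \<forall>\<^sub>F n in sequentially. 1 \<le> real n * (b - a)"
proof -
  assume "a < b"
  then obtain N where N: "1 < real N * (b - a)"
    using reals_Archimedean3[of "b - a"] by auto
  have "1 \<le> real n * (b - a)" if "n \<ge> N" for n
  proof -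
    have "real N * (b - a) \<le> n * (b - a)" using that \<open>a < b\<close> by (intro mult_right_mono) auto
    then show ?thesis using N by linarith
  qed
  then show ?thesis by (rule eventually_sequentiallyI)
qed

text \<open>Dominated convergence; the plateau product tends to the indicator of the rectangle off the four
  lines that bound it.\<close>

lemma bump_integral_tendsto:
  fixes g :: "complex \<Rightarrow> complex"
  assumes v: "v \<in> {1, \<i>}" and ab: "a < b" "c < d" and sub: "rect v a b c d \<subseteq> U" and U: "open U"
    and g: "locally_integrable U g"
  shows "(\<lambda>n. \<integral>w. bump v a b c d n w *\<^sub>R g w \<partial>lebesgue_on U)
    \<longlonglongrightarrow> (LINT w:rect v a b c d|lebesgue. g w)"
proof -
  let ?R = "rect v a b c d" and ?v = "\<i> * cnj v"
  have R: "?R \<in> sets lebesgue" using borel_rect[OF v] by (simp add: sets_completionI_sets)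
  have gi: "integrable lebesgue (\<lambda>w. indicator ?R w *\<^sub>R g w)"
  proof -
    have "integrable (lebesgue_on ?R) g"
      using g compact_rect[OF v] sub unfolding locally_integrable_def by blast
    with R show ?thesis by (simp add: integrable_restrict_space)
  qed
  have "(\<lambda>n. \<integral>w. bump v a b c d n w *\<^sub>R (indicator ?R w *\<^sub>R g w) \<partial>lebesgue)
      \<longlonglongrightarrow> (\<integral>w. indicator ?R w *\<^sub>R g w \<partial>lebesgue)"
  proof (rule integral_dominated_convergence)
    show "integrable lebesgue (\<lambda>w. norm (indicator ?R w *\<^sub>R g w))"
      using gi by (rule integrable_norm)
    show "AE w in lebesgue. norm (bump v a b c d n w *\<^sub>R (indicator ?R w *\<^sub>R g w))
        \<le> norm (indicator ?R w *\<^sub>R g w)" for n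
    proof (intro AE_I2)
      fix w
      have "\<bar>bump v a b c d n w\<bar> \<le> 1 * 1"
        unfolding bump_def abs_mult by (intro mult_mono plateau_abs_le) auto
      then show "norm (bump v a b c d n w *\<^sub>R (indicator ?R w *\<^sub>R g w))
        \<le> norm (indicator ?R w *\<^sub>R g w)"
        unfolding norm_scaleR[of "bump v a b c d n w"] by (intro mult_left_le_one_le) simp_all
    qed
    have "{w. w \<bullet> v = a} \<union> {w. w \<bullet> v = b} \<union> {w. w \<bullet> ?v = c} \<union> {w. w \<bullet> ?v = d} \<in> null_sets lebesgue"
      using negligible_standard_hyperplane frame_simps(6,7)[OF v]
      by (intro null_sets.Un) (auto simp: negligible_iff_null_sets[symmetric])
    then show "AE w in lebesgue. (\<lambda>n. bump v a b c d n w *\<^sub>R (indicator ?R w *\<^sub>R g w))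
        \<longlonglongrightarrow> indicator ?R w *\<^sub>R g w"
    proof (rule AE_I')
      show "{w \<in> space lebesgue. \<not> (\<lambda>n. bump v a b c d n w *\<^sub>R (indicator ?R w *\<^sub>R g w))
          \<longlonglongrightarrow> indicator ?R w *\<^sub>R g w}
        \<subseteq> {w. w \<bullet> v = a} \<union> {w. w \<bullet> v = b} \<union> {w. w \<bullet> ?v = c} \<union> {w. w \<bullet> ?v = d}"
      proof (rule subsetI, rule ccontr)
        fix w assume w: "w \<in> {w \<in> space lebesgue. \<not> (\<lambda>n. bump v a b c d n w *\<^sub>R (indicator ?R w *\<^sub>R g w))
          \<longlonglongrightarrow> indicator ?R w *\<^sub>R g w}"
          and "w \<notin> {w. w \<bullet> v = a} \<union> {w. w \<bullet> v = b} \<union> {w. w \<bullet> ?v = c} \<union> {w. w \<bullet> ?v = d}"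
        then have ne: "w \<bullet> v \<noteq> a" "w \<bullet> v \<noteq> b" "w \<bullet> ?v \<noteq> c" "w \<bullet> ?v \<noteq> d" by auto
        have "(\<lambda>n. bump v a b c d n w *\<^sub>R (indicator ?R w *\<^sub>R g w)) \<longlonglongrightarrow> (1 * 1) *\<^sub>R (indicator ?R w *\<^sub>R g w)"
        proof (cases "w \<in> ?R")
          case True
          then show ?thesis
            using ne unfolding bump_def rect_def
            by (intro tendsto_scaleR tendsto_mult plateau_tendsto_1 tendsto_const) auto
        qed simp
        with w show False by simp
      qed
    qed
    show "(\<lambda>w. indicator ?R w *\<^sub>R g w) \<in> borel_measurable lebesgue" using gi by auto
    show "(\<lambda>w. bump v a b c d n w *\<^sub>R (indicator ?R w *\<^sub>R g w)) \<in> borel_measurable lebesgue" for n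
    proof -
      have "continuous_on UNIV (bump v a b c d n)"
        unfolding bump_def[abs_def]
        by (intro continuous_intros continuous_on_compose2[OF continuous_plateau[of UNIV]]) auto
      then have "bump v a b c d n \<in> borel_measurable lebesgue"
        by (intro measurable_completion) (simp add: borel_measurable_continuous_onI)
      then show ?thesis by (rule borel_measurable_scaleR) (rule borel_measurable_integrable[OF gi])
    qed
  qed
  moreover have "(\<integral>w. bump v a b c d n w *\<^sub>R g w \<partial>lebesgue_on U)
      = (\<integral>w. bump v a b c d n w *\<^sub>R (indicator ?R w *\<^sub>R g w) \<partial>lebesgue)"
    if n: "1 \<le> real n * (b - a)" "1 \<le> real n * (d - c)" for n
  proof -
    have "(\<integral>w. bump v a b c d n w *\<^sub>R g w \<partial>lebesgue_on U)
        = (\<integral>w. indicator U w *\<^sub>R (bump v a b c d n w *\<^sub>R g w) \<partial>lebesgue)"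
      using U by (intro integral_restrict_space) auto
    also have "\<dots> = (\<integral>w. bump v a b c d n w *\<^sub>R (indicator ?R w *\<^sub>R g w) \<partial>lebesgue)"
      by (rule Bochner_Integration.integral_cong)
         (use sub bump_eq_0[OF n] in \<open>auto simp: indicator_def\<close>)
    finally show ?thesis .
  qed
  moreover have "\<forall>\<^sub>F n in sequentially. 1 \<le> real n * (b - a) \<and> 1 \<le> real n * (d - c)"
    using ab by (intro eventually_conj eventually_reciprocal_small)
  ultimately show ?thesis
    unfolding set_lebesgue_integral_def
    by (elim Lim_transform_eventually eventually_mono) auto
qed

text \<open>The \<open>v\<close>-derivative of the bump is a difference of spikes in the first coordinate, so the inner
  integral tends to a difference of two values of \<open>h\<close> for every \<open>t\<close>, boundedly in \<open>t\<close>.\<close>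

lemma bump_derivative_integral_tendsto:
  fixes h :: "complex \<Rightarrow> complex"
  assumes v: "v \<in> {1, \<i>}" and ab: "a < b" "c < d" and sub: "rect v a b c d \<subseteq> U" and U: "open U"
    and h: "continuous_on U h"
  shows "(\<lambda>n. \<integral>w. frechet_derivative (bump v a b c d n) (at w) v *\<^sub>R h w \<partial>lebesgue_on U)
    \<longlonglongrightarrow> (LINT t:{c..d}|lborel. h (pt v a t) - h (pt v b t))"
proof -
  let ?R = "rect v a b c d" and ?v = "\<i> * cnj v"
  define I where "I = (\<lambda>n t. integral {a..b} (\<lambda>s. (spike a n s - spike (b - 1 / n) n s) *\<^sub>R h (pt v s t)))"
  have hR: "continuous_on ?R h" using h sub by (rule continuous_on_subset)
  have hs: "continuous_on {a..b} (\<lambda>s. h (pt v s t))" if "t \<in> {c..d}" for t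
    using that by (intro continuous_on_compose2[OF hR] continuous_intros) (auto simp: pt_in_rect[OF v])
  obtain B where B: "\<And>w. w \<in> ?R \<Longrightarrow> norm (h w) \<le> B"
    using compact_imp_bounded[OF compact_continuous_image[OF hR compact_rect[OF v]]]
    by (auto simp: bounded_iff)
  obtain M where M: "\<And>x. \<bar>deriv smooth_step x\<bar> \<le> M"
    using deriv_smooth_step_bounded by blast
  have big: "\<forall>\<^sub>F n in sequentially. n > 0 \<and> 1 \<le> real n * (b - a) \<and> 1 \<le> real n * (d - c)"
    using ab by (intro eventually_conj eventually_reciprocal_small eventually_gt_at_top)
  define F where "F = (\<lambda>n w. indicator ?R w *\<^sub>R (((spike a n (w \<bullet> v) - spike (b - 1 / n) n (w \<bullet> v))
    * plateau c d n (w \<bullet> ?v)) *\<^sub>R h w))"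
  have Fi: "integrable lborel (F n)" if "n > 0" for n
  proof -
    have "continuous_on ?R (\<lambda>w. ((spike a n (w \<bullet> v) - spike (b - 1 / n) n (w \<bullet> v))
      * plateau c d n (w \<bullet> ?v)) *\<^sub>R h w)"
      using that by (intro continuous_intros hR continuous_on_compose2[OF continuous_plateau[of UNIV]]
         continuous_on_compose2[OF continuous_spike[of UNIV]]) auto
    then show ?thesis unfolding F_def by (rule borel_integrable_compact[OF compact_rect[OF v]])
  qed
  \<comment> \<open>The spikes act on the first coordinate, the plateau only on the second.\<close>
  have inner: "(\<integral>s. F n (pt v s t) \<partial>lborel) = indicator {c..d} t *\<^sub>R plateau c d n t *\<^sub>R I n t" if "n > 0" for n t
  proof (cases "t \<in> {c..d}")
    case True
    have "continuous_on {a..b} (\<lambda>s. (spike a n s - spike (b - 1 / n) n s) *\<^sub>R h (pt v s t))"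
      by (intro continuous_intros continuous_spike hs True)
    then have i: "set_integrable lborel {a..b} (\<lambda>s. (spike a n s - spike (b - 1 / n) n s) *\<^sub>R h (pt v s t))"
      by (rule borel_integrable_atLeastAtMost')
    then have "plateau c d n t *\<^sub>R I n t = plateau c d n t *\<^sub>R (LINT s:{a..b}|lborel. (spike a n s - spike (b - 1 / n) n s) *\<^sub>R h (pt v s t))"
      unfolding I_def by (simp only: set_borel_integral_eq_integral(2))
    also have "\<dots> = (\<integral>s. plateau c d n t *\<^sub>R (indicator {a..b} s *\<^sub>R (spike a n s - spike (b - 1 / n) n s) *\<^sub>R h (pt v s t)) \<partial>lborel)"
      using i unfolding set_integrable_def set_lebesgue_integral_def by (subst integral_scaleR_right) auto
    also have "\<dots> = (\<integral>s. F n (pt v s t) \<partial>lborel)"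
      by (rule Bochner_Integration.integral_cong)
         (use True in \<open>auto simp: F_def frame_simps[OF v] pt_in_rect[OF v] indicator_def\<close>)
    finally show ?thesis using True by simp
  next
    case False
    then have "F n (pt v s t) = 0" for s by (auto simp: F_def pt_in_rect[OF v] indicator_def)
    then show ?thesis using False by simp
  qed
  have eq: "(\<integral>w. frechet_derivative (bump v a b c d n) (at w) v *\<^sub>R h w \<partial>lebesgue_on U)
      = (\<integral>t. indicator {c..d} t *\<^sub>R plateau c d n t *\<^sub>R I n t \<partial>lborel)"
    if n: "n > 0" "1 \<le> real n * (b - a)" "1 \<le> real n * (d - c)" for n
  proof -
    have z: "(spike a n (w \<bullet> v) - spike (b - 1 / n) n (w \<bullet> v)) * plateau c d n (w \<bullet> ?v) = 0"
      if "w \<notin> ?R" for w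
    proof (cases "w \<bullet> v \<in> {a..b}")
      case True
      then show ?thesis using that plateau_eq_0[OF n(3)] by (auto simp: rect_def)
    next
      case False
      moreover have "1 / n \<le> b - a" using n by (simp add: field_simps)
      ultimately have "w \<bullet> v \<notin> {a..a + 1 / n}" "w \<bullet> v \<notin> {b - 1 / n..b - 1 / n + 1 / n}" by auto
      then show ?thesis using n(1) by (simp add: spike_eq_0)
    qed
    have "(\<integral>w. frechet_derivative (bump v a b c d n) (at w) v *\<^sub>R h w \<partial>lebesgue_on U)
        = (\<integral>w. indicator U w *\<^sub>R (frechet_derivative (bump v a b c d n) (at w) v *\<^sub>R h w) \<partial>lebesgue)"
      using U by (intro integral_restrict_space) auto
    also have "\<dots> = (\<integral>w. F n w \<partial>lebesgue)"
      unfolding F_def frechet_derivative_bump[OF v n(1)]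
      by (rule Bochner_Integration.integral_cong) (use sub z in \<open>auto simp: indicator_def\<close>)
    also have "\<dots> = (\<integral>w. F n w \<partial>lborel)"
      using Fi[OF n(1)] by (intro integral_completion) auto
    also have "\<dots> = (\<integral>t. indicator {c..d} t *\<^sub>R plateau c d n t *\<^sub>R I n t \<partial>lborel)"
      unfolding fubini_pt(3)[OF v Fi[OF n(1)]] inner[OF n(1)] ..
    finally show ?thesis .
  qed
  \<comment> \<open>The bound on the inner integral holds only once the two spikes fit into the interval; smaller
    indices are replaced by 0.\<close>
  have "(\<lambda>n. \<integral>t. (if 1 \<le> real n * (b - a) \<and> n > 0 then indicator {c..d} t *\<^sub>R plateau c d n t *\<^sub>R I n t else 0) \<partial>lborel)
      \<longlonglongrightarrow> (\<integral>t. indicator {c..d} t *\<^sub>R (h (pt v a t) - h (pt v b t)) \<partial>lborel)"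
  proof (rule integral_dominated_convergence)
    show "integrable lborel (\<lambda>t. indicator {c..d} t *\<^sub>R (2 * M * B))"
      using borel_integrable_compact[of "{c..d}" "\<lambda>_. 2 * M * B"] by simp
    have "continuous_on {c..d} (\<lambda>t. h (pt v a t) - h (pt v b t))"
      using ab by (intro continuous_intros continuous_on_compose2[OF hR]) (auto simp: pt_in_rect[OF v])
    then show "(\<lambda>t. indicator {c..d} t *\<^sub>R (h (pt v a t) - h (pt v b t))) \<in> borel_measurable lborel"
      by (intro borel_measurable_integrable borel_integrable_compact compact_Icc)
    have "integrable lborel (\<lambda>t. indicator {c..d} t *\<^sub>R plateau c d n t *\<^sub>R I n t)" if "n > 0" for n
      using fubini_pt(2)[OF v Fi[OF that]] by (simp only: inner[OF that])
    then show "(\<lambda>t. if 1 \<le> real n * (b - a) \<and> n > 0 then indicator {c..d} t *\<^sub>R plateau c d n t *\<^sub>R I n t else 0) \<in> borel_measurable lborel" for n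
      by (cases "1 \<le> real n * (b - a) \<and> n > 0") auto
    show "AE t in lborel. norm (if 1 \<le> real n * (b - a) \<and> n > 0 then indicator {c..d} t *\<^sub>R plateau c d n t *\<^sub>R I n t else 0) \<le> indicator {c..d} t *\<^sub>R (2 * M * B)" for n
    proof (intro AE_I2)
      fix t
      have "M \<ge> 0" using M[of 0] by linarith
      moreover have "B \<ge> 0" if "t \<in> {c..d}" 
        using order_trans[OF norm_ge_zero B[of "pt v a t"]] that ab by (auto simp: pt_in_rect[OF v])
      moreover have "\<bar>plateau c d n t\<bar> * norm (I n t) \<le> 1 * (2 * M * B)" if "t \<in> {c..d}" "1 \<le> real n * (b - a)" "n > 0"
        using that unfolding I_def
        by (intro mult_mono plateau_abs_le plateau_deriv_integral(2) ab hs M B) (auto simp: pt_in_rect[OF v])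
      ultimately show "norm (if 1 \<le> real n * (b - a) \<and> n > 0 then indicator {c..d} t *\<^sub>R plateau c d n t *\<^sub>R I n t else 0) \<le> indicator {c..d} t *\<^sub>R (2 * M * B)"
        by (auto simp: indicator_def)
    qed
    have "AE t in lborel. t \<noteq> c \<and> t \<noteq> d"
      by (intro AE_conjI AE_lborel_singleton)
    then show "AE t in lborel. (\<lambda>n. if 1 \<le> real n * (b - a) \<and> n > 0 then indicator {c..d} t *\<^sub>R plateau c d n t *\<^sub>R I n t else 0)
      \<longlonglongrightarrow> indicator {c..d} t *\<^sub>R (h (pt v a t) - h (pt v b t))"
    proof eventually_elim
      case (elim t)
      show ?case
      proof (cases "t \<in> {c..d}")
        case True
        have "(\<lambda>n. indicator {c..d} t *\<^sub>R plateau c d n t *\<^sub>R I n t) \<longlonglongrightarrow> indicator {c..d} t *\<^sub>R 1 *\<^sub>R (h (pt v a t) - h (pt v b t))"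
          unfolding I_def using True elim ab
          by (intro tendsto_scaleR tendsto_const plateau_tendsto_1 plateau_deriv_integral(1) hs) auto
        then have "(\<lambda>n. indicator {c..d} t *\<^sub>R plateau c d n t *\<^sub>R I n t)
            \<longlonglongrightarrow> indicator {c..d} t *\<^sub>R (h (pt v a t) - h (pt v b t))"
          by simp
        then show ?thesis
          by (rule Lim_transform_eventually) (use big in \<open>auto elim!: eventually_mono\<close>)
      next
        case False
        then have *: "indicat_real {c..d} t = 0" by (rule indicator_simps)
        show ?thesis unfolding * by (intro tendsto_eventually always_eventually) simp
      qed
    qed
  qed
  then show ?thesis
    unfolding set_lebesgue_integral_def
    by (rule Lim_transform_eventually) (use big eq in \<open>auto elim!: eventually_mono\<close>)
qed

text \<open>The fundamental theorem of calculus along \<open>v\<close>, integrated over the transversal coordinate.\<close>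

lemma rectangle_identity:
  assumes v: "v \<in> {1, \<i>}" and ab: "a < b" "c < d" and sub: "rect v a b c d \<subseteq> U" and U: "open U"
    and h: "continuous_on U h" and wd: "has_weak_derivative U h v (g :: complex \<Rightarrow> complex)"
  shows "(LINT t:{c..d}|lborel. h (pt v b t) - h (pt v a t)) = (LINT w:rect v a b c d|lebesgue. g w)"
proof -
  have "\<forall>\<^sub>F n in sequentially. 1 \<le> real n * (b - a) \<and> 1 \<le> real n * (d - c)"
    using ab by (intro eventually_conj eventually_reciprocal_small)
  then have "\<forall>\<^sub>F n in sequentially. (\<integral>w. frechet_derivative (bump v a b c d n) (at w) v *\<^sub>R h w \<partial>lebesgue_on U)
      = - (\<integral>w. bump v a b c d n w *\<^sub>R g w \<partial>lebesgue_on U)"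
    by eventually_elim (use wd test_function_bump[OF v _ _ sub] in \<open>auto simp: has_weak_derivative_def\<close>)
  then have "(\<lambda>n. - (\<integral>w. bump v a b c d n w *\<^sub>R g w \<partial>lebesgue_on U))
      \<longlonglongrightarrow> (LINT t:{c..d}|lborel. h (pt v a t) - h (pt v b t))"
    by (rule Lim_transform_eventually[OF bump_derivative_integral_tendsto[OF v ab sub U h]])
  moreover have "(\<lambda>n. - (\<integral>w. bump v a b c d n w *\<^sub>R g w \<partial>lebesgue_on U)) \<longlonglongrightarrow> - (LINT w:rect v a b c d|lebesgue. g w)"
    using wd by (intro tendsto_minus bump_integral_tendsto v ab sub U) (simp add: has_weak_derivative_def)
  ultimately have "(LINT t:{c..d}|lborel. h (pt v a t) - h (pt v b t)) = - (LINT w:rect v a b c d|lebesgue. g w)"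
    by (rule LIMSEQ_unique)
  moreover have "(LINT t:{c..d}|lborel. h (pt v b t) - h (pt v a t)) = - (LINT t:{c..d}|lborel. h (pt v a t) - h (pt v b t))"
    unfolding set_lebesgue_integral_def
    by (subst Bochner_Integration.integral_minus[symmetric]) (simp add: scaleR_diff_right)
  ultimately show ?thesis by simp
qed

section \<open>Sets of linear measure zero\<close>

text \<open>Vanishing one-dimensional Hausdorff measure, without the size restriction on the covering sets:
  if the diameters of a cover sum to at most \<open>e\<close> then
  each of them is at most \<open>e\<close> already.\<close>

definition H1_null :: "'a::metric_space set \<Rightarrow> bool" where
  "H1_null S \<longleftrightarrow> (\<forall>e>0. \<exists>C :: nat \<Rightarrow> 'a set. S \<subseteq> (\<Union>i. C i) \<and> (\<forall>i. bounded (C i)) \<and>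
     (\<Sum>i. ennreal (diameter (C i))) \<le> ennreal e)"

lemma hausdorff_measure_1_eq_0:
  assumes "H1_null S"
  shows "hausdorff_measure 1 S = 0"
proof -
  have small: "hausdorff_pre 1 d S \<le> 0 + ennreal e" if "d > 0" "e > 0" for d e :: real
  proof -
    have "0 < min d e" using that by simp
    from assms[unfolded H1_null_def, rule_format, OF this]
    obtain C :: "nat \<Rightarrow> 'a set" where C: "S \<subseteq> (\<Union>i. C i)" "\<And>i. bounded (C i)"
      "(\<Sum>i. ennreal (diameter (C i))) \<le> ennreal (min d e)"
      by blast
    have "ennreal (diameter (C i)) \<le> (\<Sum>i. ennreal (diameter (C i)))" for i
      using sum_le_suminf[of "\<lambda>i. ennreal (diameter (C i))" "{i}"] by simp
    with C(3) have "ennreal (diameter (C i)) \<le> ennreal (min d e)" for i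
      using order_trans by blast
    then have "diameter (C i) \<le> d" for i
      using that by (simp add: ennreal_le_iff)
    then have "hausdorff_pre 1 d S \<le> (\<Sum>i. ennreal (diameter (C i) powr 1))"
      unfolding hausdorff_pre_def using C by (intro INF_lower) auto
    also have "\<dots> = (\<Sum>i. ennreal (diameter (C i)))"
      using C(2) by (simp add: diameter_ge_0)
    also have "\<dots> \<le> ennreal (min d e)" by (rule C)
    also have "\<dots> \<le> 0 + ennreal e" by (simp add: ennreal_leI)
    finally show ?thesis .
  qed
  have "hausdorff_measure 1 S \<le> 0"
    unfolding hausdorff_measure_def
  proof (rule SUP_least)
    fix d :: real assume "d \<in> {0<..}"
    then show "hausdorff_pre 1 d S \<le> 0"
      by - (rule ennreal_le_epsilon, rule small, auto)
  qed
  then show ?thesis by simp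
qed

lemma H1_null_subset: "H1_null T \<Longrightarrow> S \<subseteq> T \<Longrightarrow> H1_null S"
  unfolding H1_null_def by (meson order_trans)

lemma H1_null_UN_nat:
  fixes S :: "nat \<Rightarrow> 'a::metric_space set"
  assumes "\<And>n. H1_null (S n)"
  shows "H1_null (\<Union>n. S n)"
  unfolding H1_null_def
proof (intro allI impI)
  fix e :: real assume "e > 0"
  have "\<exists>C :: nat \<Rightarrow> 'a set. S n \<subseteq> (\<Union>i. C i) \<and> (\<forall>i. bounded (C i)) \<and>
      (\<Sum>i. ennreal (diameter (C i))) \<le> ennreal (e * (1 / 2) ^ Suc n)" for n
    using assms[of n] \<open>e > 0\<close> unfolding H1_null_def by simp
  then obtain C :: "nat \<Rightarrow> nat \<Rightarrow> 'a set" where C: "\<And>n. S n \<subseteq> (\<Union>i. C n i)" "\<And>n i. bounded (C n i)"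
    "\<And>n. (\<Sum>i. ennreal (diameter (C n i))) \<le> ennreal (e * (1 / 2) ^ Suc n)"
    by metis
  define D where "D = (\<lambda>i. case_prod C (prod_decode i))"
  have "(\<Union>n. S n) \<subseteq> (\<Union>i. D i)"
  proof
    fix x assume "x \<in> (\<Union>n. S n)"
    then obtain n i where "x \<in> C n i" using C(1) by blast
    then have "x \<in> D (prod_encode (n, i))" by (simp add: D_def)
    then show "x \<in> (\<Union>i. D i)" by blast
  qed
  moreover have "bounded (D i)" for i
    using C(2) by (simp add: D_def split: prod.split)
  moreover have "(\<Sum>i. ennreal (diameter (D i))) \<le> ennreal e"
  proof -
    have "(\<Sum>i. ennreal (diameter (D i))) = (\<Sum>i. (case prod_decode i of (n, j) \<Rightarrow> ennreal (diameter (C n j))))"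
      by (simp add: D_def case_prod_unfold)
    also have "\<dots> = (\<Sum>n. \<Sum>j. ennreal (diameter (C n j)))"
      by (rule suminf_ennreal_2dimen) simp
    also have "\<dots> \<le> (\<Sum>n. ennreal (e * (1 / 2) ^ Suc n))"
      by (intro suminf_le C) auto
    also have "\<dots> = ennreal e"
      using sums_mult[OF power_half_series, of e] \<open>e > 0\<close>
      by (intro suminf_ennreal_eq) auto
    finally show ?thesis .
  qed
  ultimately show "\<exists>C :: nat \<Rightarrow> 'a set. (\<Union>n. S n) \<subseteq> (\<Union>i. C i) \<and> (\<forall>i. bounded (C i)) \<and>
      (\<Sum>i. ennreal (diameter (C i))) \<le> ennreal e"
    by blast
qed

lemma H1_null_UN:
  assumes "countable I" "\<And>i. i \<in> I \<Longrightarrow> H1_null (S i)"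
  shows "H1_null (\<Union>i\<in>I. S i)"
proof (cases "I = {}")
  case True
  then show ?thesis by (auto simp: H1_null_def intro!: exI[of _ "\<lambda>_. {}"])
next
  case False
  then have "(\<Union>i\<in>I. S i) = (\<Union>n. S (from_nat_into I n))"
    using range_from_nat_into[OF False assms(1)] by (metis image_image)
  then show ?thesis
    using H1_null_UN_nat[of "\<lambda>n. S (from_nat_into I n)"] assms(2) from_nat_into[OF False] by simp
qed

text \<open>Absolute continuity of the integral, obtained from outer regularity of the finite measure with
  density \<open>\<bar>G\<bar>\<close>.\<close>

lemma small_open_superset_of_null_set:
  fixes G :: "'a::euclidean_space \<Rightarrow> 'b::euclidean_space"
  assumes G: "integrable lborel G" and N: "N \<in> null_sets lborel" and "e > 0"
  obtains U where "open U" "N \<subseteq> U" "(\<integral>\<^sup>+s\<in>U. ennreal (norm (G s)) \<partial>lborel) < ennreal e"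
proof -
  let ?M = "density lborel (\<lambda>s. ennreal (norm (G s)))"
  have [measurable]: "G \<in> borel_measurable borel" using G by auto
  have ms: "emeasure ?M A = (\<integral>\<^sup>+s\<in>A. ennreal (norm (G s)) \<partial>lborel)" if "A \<in> sets borel" for A
    using that by (subst emeasure_density) auto
  have "emeasure ?M (space ?M) \<noteq> \<infinity>"
    using G by (simp add: ms integrable_iff_bounded)
  moreover have NB: "N \<in> sets borel" using N by auto
  ultimately have "emeasure ?M N = (INF U\<in>{U. N \<subseteq> U \<and> open U}. emeasure ?M U)"
    by (intro outer_regular) auto
  moreover have "emeasure ?M N = 0"
    using null_sets_density_iff[of "\<lambda>s. ennreal (norm (G s))" lborel N] N AE_not_in[OF N]
    by (force simp: null_sets_def)
  ultimately have "(INF U\<in>{U. N \<subseteq> U \<and> open U}. emeasure ?M U) < ennreal e"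
    using \<open>e > 0\<close> by simp
  then obtain U where "N \<subseteq> U" "open U" "emeasure ?M U < ennreal e"
    unfolding INF_less_iff by blast
  then show ?thesis using ms that by auto
qed

text \<open>An absolutely continuous curve maps null sets to sets of linear measure zero: cover \<open>N\<close> by
  nonoverlapping intervals inside an open set on which \<open>\<bar>G\<bar>\<close> has small integral; the diameter of
  the image of each interval is at most the integral of \<open>\<bar>G\<bar>\<close> over it.\<close>

lemma H1_null_image_of_indefinite_integral:
  fixes \<gamma> G :: "real \<Rightarrow> complex"
  assumes G: "set_integrable lborel {a..b} G"
    and \<gamma>: "\<And>x y. a \<le> x \<Longrightarrow> x \<le> y \<Longrightarrow> y \<le> b \<Longrightarrow> \<gamma> y - \<gamma> x = (LINT s:{x..y}|lborel. G s)"
    and N: "N \<in> null_sets lborel" "N \<subseteq> {a..b}"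
  shows "H1_null (\<gamma> ` N)"
  unfolding H1_null_def
proof (intro allI impI)
  fix e :: real assume "e > 0"
  define G0 where "G0 = (\<lambda>s. indicator {a..b} s *\<^sub>R G s)"
  have G0: "integrable lborel G0" using G by (simp add: G0_def set_integrable_def)
  define m where "m = (\<lambda>A. \<integral>\<^sup>+s\<in>A. ennreal (norm (G0 s)) \<partial>lborel)"
  let ?M = "density lborel (\<lambda>s. ennreal (norm (G0 s)))"
  have [measurable]: "G0 \<in> borel_measurable borel" using G0 by auto
  have M: "emeasure ?M A = m A" if "A \<in> sets borel" for A
    unfolding m_def using that by (subst emeasure_density) auto
  obtain U where U: "open U" "N \<subseteq> U" "m U < ennreal e"
    using small_open_superset_of_null_set[OF G0 N(1) \<open>e > 0\<close>] unfolding m_def by blast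
  have gauge: "gauge (\<lambda>x. if x \<in> U then U else UNIV)" using U(1) by (auto simp: gauge_def)
  have sub: "N \<subseteq> cbox (a - 1) (b + \<bar>a\<bar> + \<bar>b\<bar> + 1)"
    using N(2) by (rule order_trans) auto
  have ne: "box (a - 1) (b + \<bar>a\<bar> + \<bar>b\<bar> + 1) \<noteq> {}" by (auto simp: box_ne_empty)
  obtain \<D> where \<D>: "countable \<D>" "\<Union>\<D> \<subseteq> cbox (a - 1) (b + \<bar>a\<bar> + \<bar>b\<bar> + 1)"
    "\<And>K. K \<in> \<D> \<Longrightarrow> interior K \<noteq> {} \<and> (\<exists>c d. K = cbox c d)"
    "pairwise (\<lambda>A B. interior A \<inter> interior B = {}) \<D>"
    "\<And>K. K \<in> \<D> \<Longrightarrow> \<exists>x \<in> N \<inter> K. K \<subseteq> (if x \<in> U then U else UNIV)"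
    "\<And>u v. cbox u v \<in> \<D> \<Longrightarrow> \<exists>n. \<forall>i \<in> Basis. v \<bullet> i - u \<bullet> i =
       ((b + \<bar>a\<bar> + \<bar>b\<bar> + 1) \<bullet> i - (a - 1) \<bullet> i) / 2^n"
    "N \<subseteq> \<Union>\<D>"
    by (rule covering_lemma[OF sub ne gauge], rule that)
  \<comment> \<open>An injective enumeration of the intervals, padded with empty sets, so that the interiors form
    a disjoint sequence.\<close>
  define J where "J = (\<lambda>i. if i \<in> to_nat_on \<D> ` \<D> then from_nat_into \<D> i else {})"
  have JD: "J i = {} \<or> J i \<in> \<D>" for i
    using \<D>(1) by (auto simp: J_def)
  have J_sub: "J i \<subseteq> U" for i
    using JD[of i] \<D>(5)[of "J i"] U(2) by (auto split: if_splits)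
  have J_cover: "N \<subseteq> (\<Union>i. J i)"
  proof
    fix x assume "x \<in> N"
    then obtain K where "K \<in> \<D>" "x \<in> K" using \<D>(7) by blast
    then have "J (to_nat_on \<D> K) = K" using \<D>(1) by (auto simp: J_def)
    then show "x \<in> (\<Union>i. J i)" using \<open>x \<in> K\<close> by blast
  qed
  have disj: "disjoint_family (\<lambda>i. interior (J i))"
    unfolding disjoint_family_on_def
  proof (intro ballI impI)
    fix i j :: nat assume "i \<noteq> j"
    show "interior (J i) \<inter> interior (J j) = {}"
    proof (cases "i \<in> to_nat_on \<D> ` \<D> \<and> j \<in> to_nat_on \<D> ` \<D>")
      case True
      then obtain K L where KL: "K \<in> \<D>" "L \<in> \<D>" "i = to_nat_on \<D> K" "j = to_nat_on \<D> L" by blast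
      then have "J i = K" "J j = L" "K \<noteq> L" using \<D>(1) \<open>i \<noteq> j\<close> by (auto simp: J_def)
      then show ?thesis using \<D>(4) KL by (auto simp: pairwise_def)
    qed (auto simp: J_def)
  qed
  have bound: "norm (\<gamma> y - \<gamma> x) \<le> enn2real (m (interior (J i)))"
    if xy: "x \<in> J i \<inter> {a..b}" "y \<in> J i \<inter> {a..b}" "x \<le> y" for x y i
  proof -
    obtain c d where cd: "J i = {c..d}" using JD[of i] \<D>(3) xy by fastforce
    have "\<gamma> y - \<gamma> x = (\<integral>s. indicator {x..y} s *\<^sub>R G0 s \<partial>lborel)"
      using \<gamma>[of x y] xy unfolding set_lebesgue_integral_def G0_def
      by (auto intro!: Bochner_Integration.integral_cong simp: indicator_def)
    moreover have "integrable lborel (\<lambda>s. indicator {x..y} s *\<^sub>R G0 s)"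
      by (rule integrable_mult_indicator[OF _ G0]) auto
    ultimately have "ennreal (norm (\<gamma> y - \<gamma> x)) \<le> (\<integral>\<^sup>+s. ennreal (norm (indicator {x..y} s *\<^sub>R G0 s)) \<partial>lborel)"
      using integral_norm_bound_ennreal by metis
    also have "\<dots> \<le> m (interior (J i))"
      unfolding m_def
    proof (rule nn_integral_mono_AE)
      have "AE s in lborel. s \<noteq> c \<and> s \<noteq> d"
        by (intro AE_conjI AE_lborel_singleton)
      then show "AE s in lborel. ennreal (norm (indicator {x..y} s *\<^sub>R G0 s))
          \<le> ennreal (norm (G0 s)) * indicator (interior (J i)) s"
        by eventually_elim (use xy in \<open>auto simp: cd indicator_def\<close>)
    qed
    finally have 1: "ennreal (norm (\<gamma> y - \<gamma> x)) \<le> m (interior (J i))" .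
    have "m (interior (J i)) \<le> m UNIV"
      unfolding m_def by (intro nn_integral_mono) (auto simp: indicator_def)
    also have "\<dots> < \<infinity>" using G0 by (simp add: m_def integrable_iff_bounded)
    finally show ?thesis using 1 by (metis enn2real_ennreal enn2real_mono norm_ge_zero infinity_ennreal_def)
  qed
  define C where "C = (\<lambda>i. \<gamma> ` (J i \<inter> {a..b}))"
  have dist: "norm (z - w) \<le> enn2real (m (interior (J i)))" if zw: "z \<in> C i" "w \<in> C i" for z w i
  proof -
    obtain x y where xy: "z = \<gamma> y" "w = \<gamma> x" "x \<in> J i \<inter> {a..b}" "y \<in> J i \<inter> {a..b}"
      using zw unfolding C_def by blast
    show ?thesis
      using bound[of x i y] bound[of y i x] xy by (cases "x \<le> y") (auto simp: norm_minus_commute)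
  qed
  have "\<gamma> ` N \<subseteq> (\<Union>i. C i)"
  proof (rule image_subsetI)
    fix x assume "x \<in> N"
    then obtain i where "x \<in> J i" using J_cover by auto
    with \<open>x \<in> N\<close> N(2) have "\<gamma> x \<in> C i" unfolding C_def by (intro imageI) auto
    then show "\<gamma> x \<in> (\<Union>i. C i)" by auto
  qed
  moreover have "bounded (C i)" for i
    using dist unfolding bounded_two_points dist_norm by (intro exI ballI)
  moreover have "(\<Sum>i. ennreal (diameter (C i))) \<le> ennreal e"
  proof -
    have "(\<Sum>i. ennreal (diameter (C i))) \<le> (\<Sum>i. m (interior (J i)))"
    proof (intro suminf_le)
      fix i
      have "diameter (C i) \<le> enn2real (m (interior (J i)))"
        using dist by (intro diameter_le) auto
      then have "ennreal (diameter (C i)) \<le> ennreal (enn2real (m (interior (J i))))"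
        by (rule ennreal_leI)
      also have "\<dots> \<le> m (interior (J i))"
        by (cases "m (interior (J i))") auto
      finally show "ennreal (diameter (C i)) \<le> m (interior (J i))" .
    qed auto
    also have "\<dots> = (\<Sum>i. emeasure ?M (interior (J i)))" by (simp add: M)
    also have "\<dots> = emeasure ?M (\<Union>i. interior (J i))"
      using disj by (intro suminf_emeasure) auto
    also have "\<dots> \<le> emeasure ?M U"
      using J_sub interior_subset[of "J _"] U(1) by (intro emeasure_mono UN_least) (auto dest: subsetD)
    also have "\<dots> \<le> ennreal e" using U by (simp add: M)
    finally show ?thesis .
  qed
  ultimately show "\<exists>C :: nat \<Rightarrow> complex set. \<gamma> ` N \<subseteq> (\<Union>i. C i) \<and> (\<forall>i. bounded (C i)) \<and>
      (\<Sum>i. ennreal (diameter (C i))) \<le> ennreal e"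
    by blast
qed

section \<open>Absolute continuity on almost every line\<close>

text \<open>The positive and the negative part are densities of two finite measures that agree on all
  compact intervals, hence everywhere.\<close>

lemma AE_zero_if_interval_integrals_zero:
  fixes u :: "real \<Rightarrow> real"
  assumes u: "integrable lborel u"
    and zero: "\<And>x y. (\<integral>s. indicator {x..y} s *\<^sub>R u s \<partial>lborel) = 0"
  shows "AE s in lborel. u s = 0"
proof -
  have [measurable]: "u \<in> borel_measurable borel" using u by auto
  let ?P = "density lborel (\<lambda>s. ennreal (u s))" and ?N = "density lborel (\<lambda>s. ennreal (- u s))"
  have fin: "(\<integral>\<^sup>+s. ennreal (f s) \<partial>lborel) \<noteq> \<infinity>" if "integrable lborel f" for f :: "real \<Rightarrow> real"
    using that by (simp add: real_integrable_def)
  have part: "emeasure (density lborel (\<lambda>s. ennreal (f s))) {x..y}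
      = (\<integral>\<^sup>+s. ennreal (indicator {x..y} s *\<^sub>R f s) \<partial>lborel)"
    if [measurable]: "f \<in> borel_measurable borel" for f :: "real \<Rightarrow> real" and x y
    by (subst emeasure_density) (auto intro!: nn_integral_cong simp: indicator_def)
  have eq: "emeasure ?P {x..y} = emeasure ?N {x..y}" for x y
  proof -
    have i: "integrable lborel (\<lambda>s. indicator {x..y} s *\<^sub>R u s)"
      by (rule integrable_mult_indicator[OF _ u]) auto
    then have i': "integrable lborel (\<lambda>s. indicator {x..y} s *\<^sub>R - u s)" by simp
    have "emeasure ?P {x..y} = (\<integral>\<^sup>+s. ennreal (indicator {x..y} s *\<^sub>R u s) \<partial>lborel)"
      "emeasure ?N {x..y} = (\<integral>\<^sup>+s. ennreal (indicator {x..y} s *\<^sub>R - u s) \<partial>lborel)"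
      by (intro part; simp)+
    moreover have "enn2real (\<integral>\<^sup>+s. ennreal (indicator {x..y} s *\<^sub>R u s) \<partial>lborel)
        = enn2real (\<integral>\<^sup>+s. ennreal (indicator {x..y} s *\<^sub>R - u s) \<partial>lborel)"
      using zero[of x y] real_lebesgue_integral_def[OF i] by simp
    ultimately show ?thesis
      using fin[OF i] fin[OF i'] by (metis ennreal_enn2real infinity_ennreal_def top.not_eq_extremum)
  qed
  have "?P = ?N"
  proof (rule measure_eqI_generator_eq)
    let ?E = "range (\<lambda>(x, y). {x..y :: real})"
    show "Int_stable ?E"
    proof (rule Int_stableI)
      fix A B :: "real set" assume "A \<in> ?E" "B \<in> ?E"
      then obtain x y z w where "A = {x..y}" "B = {z..w}" by auto
      then have "A \<inter> B = (\<lambda>(x, y). {x..y}) (max x z, min y w)" by auto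
      then show "A \<inter> B \<in> ?E" by (rule range_eqI)
    qed
    show "sets ?P = sigma_sets UNIV ?E" "sets ?N = sigma_sets UNIV ?E"
      using arg_cong[OF borel_eq_atLeastAtMost[where 'a = real], of sets]
      by (simp_all add: sets_measure_of)
    show "range (\<lambda>n. {- real n..real n}) \<subseteq> ?E" by auto
    show "(\<Union>n. {- real n..real n}) = UNIV"
    proof (intro equalityI subsetI UNIV_I)
      fix x :: real
      obtain n where "\<bar>x\<bar> \<le> real n" using real_arch_simple by blast
      then have "x \<in> {- real n..real n}" by auto
      then show "x \<in> (\<Union>n. {- real n..real n})" by (rule UN_I[OF UNIV_I])
    qed
    show "emeasure ?P {- real n..real n} \<noteq> \<infinity>" for n
    proof -
      have "emeasure ?P {- real n..real n} \<le> emeasure ?P UNIV" by (intro emeasure_mono) auto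
      also have "\<dots> = (\<integral>\<^sup>+s. ennreal (u s) \<partial>lborel)" by (subst emeasure_density) auto
      finally show ?thesis using fin[OF u] by (auto simp: top_unique)
    qed
    show "emeasure ?P X = emeasure ?N X" if "X \<in> ?E" for X
      using that eq by auto
  qed auto
  then have "AE s in lborel. ennreal (u s) = ennreal (- u s)"
    by (subst (asm) sigma_finite_measure.density_unique_iff[OF lborel.sigma_finite_measure_axioms]) auto
  then show ?thesis
    by eventually_elim (metis ennreal_eq_0_iff ennreal_neg linorder_linear neg_0_le_iff_le neg_le_0_iff_le order_antisym)
qed

lemma AE_zero_if_interval_integrals_zero_complex:
  fixes u :: "real \<Rightarrow> complex"
  assumes u: "integrable lborel u"
    and zero: "\<And>x y. (\<integral>s. indicator {x..y} s *\<^sub>R u s \<partial>lborel) = 0"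
  shows "AE s in lborel. u s = 0"
proof -
  have i: "integrable lborel (\<lambda>s. indicator {x..y} s *\<^sub>R u s)" for x y
    by (rule integrable_mult_indicator[OF _ u]) auto
  have "(\<integral>s. indicator {x..y} s *\<^sub>R Re (u s) \<partial>lborel) = 0"
    "(\<integral>s. indicator {x..y} s *\<^sub>R Im (u s) \<partial>lborel) = 0" for x y
    using integral_Re[OF i[of x y]] integral_Im[OF i[of x y]] zero[of x y] by simp_all
  then have "AE s in lborel. Re (u s) = 0" "AE s in lborel. Im (u s) = 0"
    using u by (auto intro!: AE_zero_if_interval_integrals_zero)
  then show ?thesis by eventually_elim (simp add: complex_eq_iff)
qed

text \<open>Fubini is applied to the product of two Borel measures, whereas a weak derivative is only
  Lebesgue measurable.\<close>

lemma borel_representative: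
  fixes f :: "'a::euclidean_space \<Rightarrow> complex"
  assumes "integrable lebesgue f"
  obtains F where "integrable lborel F" "AE x in lebesgue. f x = F x"
proof -
  have "(\<lambda>x. Re (f x)) \<in> borel_measurable lebesgue" "(\<lambda>x. Im (f x)) \<in> borel_measurable lebesgue"
    using assms by auto
  from this[THEN completion_ex_borel_measurable_real]
  obtain R I where RI: "R \<in> borel_measurable lborel" "AE x in lborel. Re (f x) = R x"
    "I \<in> borel_measurable lborel" "AE x in lborel. Im (f x) = I x"
    by auto
  define F where "F = (\<lambda>x. complex_of_real (R x) + \<i> * complex_of_real (I x))"
  have [measurable]: "R \<in> borel_measurable borel" "I \<in> borel_measurable borel" using RI by auto
  have m: "F \<in> borel_measurable lborel"
    unfolding F_def by measurable
  have "AE x in lborel. f x = F x"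
    using RI(2,4) by eventually_elim (simp add: F_def complex_eq_iff)
  then have ae: "AE x in lebesgue. f x = F x" by (rule AE_completion)
  moreover have "integrable lebesgue F"
    using assms by (rule integrable_cong_AE_imp) (use ae m measurable_completion[OF m] in auto)
  then have "integrable lborel F" using m by (simp add: integrable_completion)
  ultimately show ?thesis using that by blast
qed

text \<open>For a fixed right endpoint \<open>y\<close> the rectangle identity, valid for all subintervals of \<open>{c..d}\<close>,
  determines the integrand for almost every \<open>t\<close>. Rational endpoints have a common exceptional set, and
  for all other \<open>t\<close> both sides are continuous in \<open>y\<close>.\<close>

lemma weak_derivative_integrates_on_ae_line:
  assumes v: "v \<in> {1, \<i>}" and ab: "a < b" "c < d" and sub: "rect v a b c d \<subseteq> U" and U: "open U"
    and h: "continuous_on U h" and wd: "has_weak_derivative U h v (g :: complex \<Rightarrow> complex)"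
  obtains G where
    "AE t in lborel. t \<in> {c..d} \<longrightarrow> set_integrable lborel {a..b} (\<lambda>s. G (pt v s t)) \<and>
       (\<forall>x y. a \<le> x \<longrightarrow> x \<le> y \<longrightarrow> y \<le> b \<longrightarrow>
          h (pt v y t) - h (pt v x t) = (LINT s:{x..y}|lborel. G (pt v s t)))"
proof -
  let ?R = "rect v a b c d"
  have Rleb: "rect v a b c d \<in> sets lebesgue" for a b c d
    using borel_rect[OF v] by (simp add: sets_completionI_sets)
  have hR: "continuous_on ?R h" using h sub by (rule continuous_on_subset)
  have "integrable (lebesgue_on ?R) g"
  proof -
    have "locally_integrable U g" using wd by (simp add: has_weak_derivative_def)
    then show ?thesis using compact_rect[OF v] sub unfolding locally_integrable_def by blast
  qed
  then have g0: "integrable lebesgue (\<lambda>w. indicator ?R w *\<^sub>R g w)"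
    using Rleb by (simp add: integrable_restrict_space)
  obtain G where G: "integrable lborel G" and ae: "AE w in lebesgue. indicator ?R w *\<^sub>R g w = G w"
    by (rule borel_representative[OF g0])
  have Gi: "integrable lborel (\<lambda>w. indicator (rect v x y z q) w *\<^sub>R G w)" for x y z q
    by (rule integrable_mult_indicator[OF _ G]) (use v in auto)
  have slice: "(\<integral>s. indicator (rect v x y z q) (pt v s t) *\<^sub>R G (pt v s t) \<partial>lborel)
      = indicator {z..q} t *\<^sub>R (LINT s:{x..y}|lborel. G (pt v s t))" for x y z q t
    unfolding set_lebesgue_integral_def
    by (cases "t \<in> {z..q}") (auto simp: pt_in_rect[OF v] indicator_def)
  have rect_G: "(LINT w:rect v a y z q|lebesgue. g w) = (LINT t:{z..q}|lborel. LINT s:{a..y}|lborel. G (pt v s t))"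
    if "y \<le> b" "c \<le> z" "q \<le> d" for y z q
  proof -
    have "rect v a y z q \<subseteq> ?R" using that by (auto simp: rect_def)
    then have "(LINT w:rect v a y z q|lebesgue. g w)
        = (\<integral>w. indicator (rect v a y z q) w *\<^sub>R (indicator ?R w *\<^sub>R g w) \<partial>lebesgue)"
      unfolding set_lebesgue_integral_def
      by (intro Bochner_Integration.integral_cong) (auto simp: indicator_def)
    also have "\<dots> = (\<integral>w. indicator (rect v a y z q) w *\<^sub>R G w \<partial>lebesgue)"
    proof (rule integral_cong_AE)
      show "(\<lambda>w. indicator (rect v a y z q) w *\<^sub>R (indicator ?R w *\<^sub>R g w)) \<in> borel_measurable lebesgue"
        by (rule borel_measurable_integrable, rule integrable_mult_indicator[OF Rleb g0])
      show "(\<lambda>w. indicator (rect v a y z q) w *\<^sub>R G w) \<in> borel_measurable lebesgue"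
        by (rule measurable_completion, rule borel_measurable_integrable, rule Gi)
      show "AE w in lebesgue. indicator (rect v a y z q) w *\<^sub>R (indicator ?R w *\<^sub>R g w)
          = indicator (rect v a y z q) w *\<^sub>R G w"
        using ae by eventually_elim simp
    qed
    also have "\<dots> = (\<integral>w. indicator (rect v a y z q) w *\<^sub>R G w \<partial>lborel)"
      using Gi by (intro integral_completion) auto
    also have "\<dots> = (LINT t:{z..q}|lborel. LINT s:{a..y}|lborel. G (pt v s t))"
      unfolding fubini_pt(3)[OF v Gi] slice set_lebesgue_integral_def ..
    finally show ?thesis .
  qed
  have endpoint: "AE t in lborel. t \<in> {c..d} \<longrightarrow> h (pt v y t) - h (pt v a t) = (LINT s:{a..y}|lborel. G (pt v s t))"
    if y: "a < y" "y \<le> b" for y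
  proof -
    define u where "u = (\<lambda>t. indicator {c..d} t *\<^sub>R (h (pt v y t) - h (pt v a t))
      - indicator {c..d} t *\<^sub>R (LINT s:{a..y}|lborel. G (pt v s t)))"
    have hc: "continuous_on {z..q} (\<lambda>t. h (pt v y t) - h (pt v a t))" if "c \<le> z" "q \<le> d" for z q
      using that y by (intro continuous_intros continuous_on_compose2[OF hR]) (auto simp: pt_in_rect[OF v])
    have hi: "integrable lborel (\<lambda>t. indicator {z..q} t *\<^sub>R (h (pt v y t) - h (pt v a t)))"
      if "c \<le> z" "q \<le> d" for z q
      using hc[OF that] by (intro borel_integrable_compact compact_Icc)
    have Gs: "integrable lborel (\<lambda>t. indicator {z..q} t *\<^sub>R (LINT s:{a..y}|lborel. G (pt v s t)))" for z q
      using fubini_pt(2)[OF v Gi[of a y z q]] unfolding slice .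
    have "integrable lborel u"
      unfolding u_def by (intro Bochner_Integration.integrable_diff hi Gs) auto
    moreover have "(\<integral>t. indicator {x..x'} t *\<^sub>R u t \<partial>lborel) = 0" for x x'
    proof -
      define z where "z = max c x"
      define q where "q = min d x'"
      have "(\<integral>t. indicator {x..x'} t *\<^sub>R u t \<partial>lborel)
        = (\<integral>t. indicator {z..q} t *\<^sub>R (h (pt v y t) - h (pt v a t))
            - indicator {z..q} t *\<^sub>R (LINT s:{a..y}|lborel. G (pt v s t)) \<partial>lborel)"
        by (rule Bochner_Integration.integral_cong) (auto simp: u_def z_def q_def indicator_def)
      also have "\<dots> = (LINT t:{z..q}|lborel. h (pt v y t) - h (pt v a t))
          - (LINT t:{z..q}|lborel. LINT s:{a..y}|lborel. G (pt v s t))"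
        unfolding set_lebesgue_integral_def
        by (intro Bochner_Integration.integral_diff hi Gs[unfolded set_lebesgue_integral_def]) (auto simp: z_def q_def)
      also have "\<dots> = 0"
      \<comment> \<open>Otherwise the interval is empty or a single point.\<close>
      proof (cases "z < q")
        case True
        have "rect v a y z q \<subseteq> U"
          using sub y by (auto simp: rect_def z_def q_def)
        then have "(LINT t:{z..q}|lborel. h (pt v y t) - h (pt v a t)) = (LINT w:rect v a y z q|lebesgue. g w)"
          using True y by (intro rectangle_identity[OF v _ _ _ U h wd])
        also have "\<dots> = (LINT t:{z..q}|lborel. LINT s:{a..y}|lborel. G (pt v s t))"
          using y by (intro rect_G) (auto simp: z_def q_def)
        finally show ?thesis by simp
      next
        case False
        have null: "(LINT t:{z..q}|lborel. f t) = 0" for f :: "real \<Rightarrow> complex"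
        proof -
          have "AE t in lborel. indicator {z..q} t *\<^sub>R f t = 0"
            using AE_lborel_singleton[of z] by eventually_elim (use False in \<open>auto simp: indicator_def\<close>)
          then show ?thesis unfolding set_lebesgue_integral_def by (rule integral_eq_zero_AE)
        qed
        show ?thesis unfolding null by simp
      qed
      finally show ?thesis .
    qed
    ultimately have "AE t in lborel. u t = 0" by (rule AE_zero_if_interval_integrals_zero_complex)
    then show ?thesis
      by eventually_elim (auto simp: u_def)
  qed
  have "AE t in lborel. \<forall>y\<in>{a<..<b} \<inter> \<rat>. t \<in> {c..d} \<longrightarrow>
      h (pt v y t) - h (pt v a t) = (LINT s:{a..y}|lborel. G (pt v s t))"
    using endpoint by (subst AE_ball_countable) (auto intro: countable_subset[OF _ countable_rat])
  then have "AE t in lborel. t \<in> {c..d} \<longrightarrow> set_integrable lborel {a..b} (\<lambda>s. G (pt v s t)) \<and>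
       (\<forall>x y. a \<le> x \<longrightarrow> x \<le> y \<longrightarrow> y \<le> b \<longrightarrow>
          h (pt v y t) - h (pt v x t) = (LINT s:{x..y}|lborel. G (pt v s t)))"
    using fubini_pt(1)[OF v G]
  proof eventually_elim
    case (elim t)
    show ?case
    proof (intro impI conjI allI)
      assume t: "t \<in> {c..d}"
      have si: "set_integrable lborel {x..y} (\<lambda>s. G (pt v s t))" for x y
        unfolding set_integrable_def by (rule integrable_mult_indicator[OF _ elim(2)]) auto
      show "set_integrable lborel {a..b} (\<lambda>s. G (pt v s t))" by (rule si)
      note HK = set_borel_integral_eq_integral[OF si]
      have cont: "continuous_on {a..b} (\<lambda>y. h (pt v y t) - h (pt v a t) - integral {a..y} (\<lambda>s. G (pt v s t)))"
        using t ab by (intro continuous_intros continuous_on_compose2[OF hR] indefinite_integral_continuous_1 HK(1))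
          (auto simp: pt_in_rect[OF v])
      have cl: "closure ({a<..<b} \<inter> \<rat>) = {a..b}"
        using closure_open_Int_superset[of "{a<..<b}" \<rat>] ab by (simp add: Rats_closure_real)
      have P: "h (pt v y t) - h (pt v a t) = integral {a..y} (\<lambda>s. G (pt v s t))" if y: "y \<in> {a..b}" for y
      proof -
        have "h (pt v y t) - h (pt v a t) - integral {a..y} (\<lambda>s. G (pt v s t)) = 0"
        proof (rule continuous_constant_on_closure[of "{a<..<b} \<inter> \<rat>"
            "\<lambda>y. h (pt v y t) - h (pt v a t) - integral {a..y} (\<lambda>s. G (pt v s t))" 0 y])
          show "h (pt v x t) - h (pt v a t) - integral {a..x} (\<lambda>s. G (pt v s t)) = 0"
            if "x \<in> {a<..<b} \<inter> \<rat>" for x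
            using elim(1) that t HK(2)[of a x] by auto
        qed (use cont y cl in auto)
        then show ?thesis by simp
      qed
      fix x y assume xy: "a \<le> x" "x \<le> y" "y \<le> b"
      have "integral {a..x} (\<lambda>s. G (pt v s t)) + integral {x..y} (\<lambda>s. G (pt v s t))
          = integral {a..y} (\<lambda>s. G (pt v s t))"
        using xy HK(1) by (intro Henstock_Kurzweil_Integration.integral_combine)
      then show "h (pt v y t) - h (pt v x t) = (LINT s:{x..y}|lborel. G (pt v s t))"
        using P[of x] P[of y] xy HK(2)[of x y] by (simp add: algebra_simps)
    qed
  qed
  then show ?thesis by (rule that)
qed

lemma AE_slice_null:
  assumes v: "v \<in> {1, \<i>}" and E: "E \<in> null_sets lborel"
  shows "AE t in lborel. {s. pt v s t \<in> E} \<in> null_sets lborel"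
proof -
  have [measurable]: "E \<in> sets borel" using E by auto
  have m: "{p \<in> space (lborel \<Otimes>\<^sub>M lborel). pt v (fst p) (snd p) \<notin> E} \<in> sets (lborel \<Otimes>\<^sub>M lborel)"
  proof -
    have [measurable]: "(\<lambda>p. pt v (fst p) (snd p)) \<in> borel \<Otimes>\<^sub>M borel \<rightarrow>\<^sub>M borel"
      using pt_measurable[of v] by (simp add: case_prod_unfold)
    have "{p \<in> space (borel \<Otimes>\<^sub>M borel). pt v (fst p) (snd p) \<notin> E} \<in> sets (borel \<Otimes>\<^sub>M borel)"
      by measurable
    moreover have "sets (lborel \<Otimes>\<^sub>M lborel) = sets (borel \<Otimes>\<^sub>M (borel :: real measure) :: (real \<times> real) measure)"
      by (intro sets_pair_measure_cong) auto
    ultimately show ?thesis by (simp add: space_pair_measure)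
  qed
  have "AE w in distr (lborel \<Otimes>\<^sub>M lborel) borel (\<lambda>(s, t). pt v s t). w \<notin> E"
    unfolding lborel_distr_pt[OF v] using E by (rule AE_not_in)
  then have "AE p in lborel \<Otimes>\<^sub>M lborel. pt v (fst p) (snd p) \<notin> E"
    using pt_measurable[of v] by (subst (asm) AE_distr_iff) (auto simp: case_prod_unfold)
  then have "AE s in lborel. AE t in lborel. pt v s t \<notin> E"
    using lborel_pair.AE_pair by fastforce
  then have "AE t in lborel. AE s in lborel. pt v s t \<notin> E"
    using lborel_pair.AE_commute[of "\<lambda>s t. pt v s t \<notin> E"] m by simp
  then show ?thesis
  proof eventually_elim
    case (elim t)
    have "(\<lambda>s. pt v s t) \<in> borel_measurable borel" unfolding pt_def by measurable
    then have "{s. pt v s t \<in> E} \<in> sets borel"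
      using measurable_sets[of "\<lambda>s. pt v s t" borel borel E] by (simp add: vimage_def)
    with elim show ?case by (simp add: AE_iff_null)
  qed
qed

lemma AE_line_image_H1_null:
  assumes v: "v \<in> {1, \<i>}" and ab: "a < b" "c < d" and sub: "rect v a b c d \<subseteq> U" and U: "open U"
    and h: "continuous_on U h" and wd: "has_weak_derivative U h v (g :: complex \<Rightarrow> complex)"
    and E: "E \<in> null_sets lborel"
  shows "AE t in lborel. t \<in> {c..d} \<longrightarrow> H1_null (h ` {w \<in> E \<inter> rect v a b c d. w \<bullet> (\<i> * cnj v) = t})"
proof -
  obtain G where "AE t in lborel. t \<in> {c..d} \<longrightarrow> set_integrable lborel {a..b} (\<lambda>s. G (pt v s t)) \<and>
       (\<forall>x y. a \<le> x \<longrightarrow> x \<le> y \<longrightarrow> y \<le> b \<longrightarrow>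
          h (pt v y t) - h (pt v x t) = (LINT s:{x..y}|lborel. G (pt v s t)))"
    by (rule weak_derivative_integrates_on_ae_line[OF v ab sub U h wd])
  then show ?thesis using AE_slice_null[OF v E]
  proof eventually_elim
    case (elim t)
    show ?case
    proof
      assume t: "t \<in> {c..d}"
      have "{a..b} \<inter> {s. pt v s t \<in> E} \<in> null_sets lborel"
        using elim(2) by (intro null_set_Int1) auto
      then have "H1_null ((\<lambda>s. h (pt v s t)) ` ({a..b} \<inter> {s. pt v s t \<in> E}))"
        using elim(1) t by (intro H1_null_image_of_indefinite_integral) auto
      moreover have "h ` {w \<in> E \<inter> rect v a b c d. w \<bullet> (\<i> * cnj v) = t}
          \<subseteq> (\<lambda>s. h (pt v s t)) ` ({a..b} \<inter> {s. pt v s t \<in> E})"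
      proof (rule image_subsetI)
        fix w assume "w \<in> {w \<in> E \<inter> rect v a b c d. w \<bullet> (\<i> * cnj v) = t}"
        then have "w = pt v (w \<bullet> v) t" "w \<in> E" "w \<bullet> v \<in> {a..b}"
          using frame_simps(3)[OF v, of w] by (auto simp: rect_def)
        then show "h w \<in> (\<lambda>s. h (pt v s t)) ` ({a..b} \<inter> {s. pt v s t \<in> E})"
          by (intro image_eqI[of _ _ "w \<bullet> v"]) auto
      qed
      ultimately show "H1_null (h ` {w \<in> E \<inter> rect v a b c d. w \<bullet> (\<i> * cnj v) = t})"
        by (rule H1_null_subset)
    qed
  qed
qed

section \<open>A weak Cauchy-Riemann equation implies holomorphy\<close>

text \<open>The two rectangle identities combine to the vanishing of the integral of \<open>h\<close> around every rectangle.
  So a primitive can be defined by integrating from the corner of a square along either of the two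
  paths made of a horizontal and a vertical segment; one path yields each partial derivative.\<close>

lemma holomorphic_if_weak_dbar_zero:
  assumes U: "open U" and h: "continuous_on U h"
    and g1: "has_weak_derivative U h 1 g1" and g2: "has_weak_derivative U h \<i> g2"
    and CR: "AE w in lebesgue_on U. g1 w + \<i> * g2 w = 0"
  shows "h holomorphic_on U"
proof -
  have "\<exists>Q. open Q \<and> z0 \<in> Q \<and> h holomorphic_on Q" if z0: "z0 \<in> U" for z0
  proof -
    obtain r where r: "r > 0" "cball z0 r \<subseteq> U"
      using open_contains_cball[THEN iffD1, OF U] z0 by blast
    define a b c d where "a = Re z0 - r / 2" and "b = Re z0 + r / 2"
      and "c = Im z0 - r / 2" and "d = Im z0 + r / 2"
    note abcd_def = a_def b_def c_def d_def
    have inU: "Complex x y \<in> U" if "x \<in> {a..b}" "y \<in> {c..d}" for x y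
    proof -
      have "\<bar>Re (z0 - Complex x y)\<bar> \<le> r / 2" "\<bar>Im (z0 - Complex x y)\<bar> \<le> r / 2"
        using that by (auto simp: abcd_def abs_if)
      then have "dist z0 (Complex x y) \<le> r"
        unfolding dist_norm using cmod_le[of "z0 - Complex x y"] by linarith
      then show ?thesis using r by auto
    qed
    define H where "H = (\<lambda>p. h (Complex (fst p) (snd p)))"
    have H: "continuous_on ({a..b} \<times> {c..d}) H"
      unfolding H_def complex_eq
      by (intro continuous_on_compose2[OF h] continuous_intros) (use inU in \<open>auto simp: complex_eq\<close>)
    have Hx: "continuous_on {a..b} (\<lambda>x. H (x, y))" if "y \<in> {c..d}" for y
      by (intro continuous_on_compose2[OF H] continuous_intros) (use that in auto)
    have Hy: "continuous_on {c..d} (\<lambda>y. H (x, y))" if "x \<in> {a..b}" for x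
      by (intro continuous_on_compose2[OF H] continuous_intros) (use that in auto)
    define F where "F = (\<lambda>x y. integral {a..x} (\<lambda>t. H (t, c)) + \<i> * integral {c..y} (\<lambda>t. H (x, t)))"
    \<comment> \<open>The other path from the corner to \<open>x + \<i> y\<close>.\<close>
    have F_alt: "F x y = \<i> * integral {c..y} (\<lambda>t. H (a, t)) + integral {a..x} (\<lambda>t. H (t, y))"
      if x: "a < x" "x \<le> b" and y: "c < y" "y \<le> d" for x y
    proof -
      have pt: "pt 1 s t = Complex s t" "pt \<i> s t = Complex t s" for s t
        by (simp_all add: pt_def complex_eq_iff)
      let ?R = "rect 1 a x c y"
      have R: "?R = rect \<i> c y a x" by (auto simp: rect_def inner_complex_def)
      have sub: "?R \<subseteq> U"
      proof
        fix w assume "w \<in> ?R"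
        then have "Re w \<in> {a..b}" "Im w \<in> {c..d}" using x y by (auto simp: rect_def inner_complex_def)
        then show "w \<in> U" using inU[of "Re w" "Im w"] by simp
      qed
      have K: "compact ?R" by (rule compact_rect) simp
      have RL: "?R \<in> sets lebesgue" using borel_rect[of 1] by (simp add: sets_completionI_sets)
      have i: "integrable lebesgue (\<lambda>w. indicator ?R w *\<^sub>R g w)" if "has_weak_derivative U h v g" for g :: "complex \<Rightarrow> complex" and v
      proof -
        have "locally_integrable U g" using that by (simp add: has_weak_derivative_def)
        then have "integrable (lebesgue_on ?R) g" using K sub unfolding locally_integrable_def by blast
        then show ?thesis using RL by (simp add: integrable_restrict_space)
      qed
      have I1: "integral {c..y} (\<lambda>t. H (x, t) - H (a, t)) = (LINT w:?R|lebesgue. g1 w)"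
      proof -
        have "set_integrable lborel {c..y} (\<lambda>t. H (x, t) - H (a, t))"
          using x y by (intro borel_integrable_atLeastAtMost' continuous_intros continuous_on_subset[OF Hy]) auto
        from set_borel_integral_eq_integral(2)[OF this] show ?thesis
          using rectangle_identity[OF _ x(1) y(1) sub U h g1] by (simp add: pt H_def)
      qed
      have I2: "integral {a..x} (\<lambda>t. H (t, y) - H (t, c)) = (LINT w:?R|lebesgue. g2 w)"
      proof -
        have "set_integrable lborel {a..x} (\<lambda>t. H (t, y) - H (t, c))"
          using x y by (intro borel_integrable_atLeastAtMost' continuous_intros continuous_on_subset[OF Hx]) auto
        from set_borel_integral_eq_integral(2)[OF this] show ?thesis
          using rectangle_identity[OF _ y(1) x(1) _ U h g2] sub by (simp add: pt H_def R)
      qed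
      have "AE w in lebesgue. indicator ?R w *\<^sub>R g1 w + \<i> * (indicator ?R w *\<^sub>R g2 w) = 0"
      proof -
        have "AE w in lebesgue. w \<in> U \<longrightarrow> g1 w + \<i> * g2 w = 0"
          using CR U by (subst (asm) AE_restrict_space_iff) auto
        then show ?thesis
          by eventually_elim (use sub in \<open>auto simp: indicator_def\<close>)
      qed
      then have "(\<integral>w. indicator ?R w *\<^sub>R g1 w + \<i> * (indicator ?R w *\<^sub>R g2 w) \<partial>lebesgue) = 0"
        by (rule integral_eq_zero_AE)
      then have "(LINT w:?R|lebesgue. g1 w) + \<i> * (LINT w:?R|lebesgue. g2 w) = 0"
        unfolding set_lebesgue_integral_def
        by (subst (asm) Bochner_Integration.integral_add)
           (auto intro: i[OF g1] i[OF g2] simp del: mult_scaleR_right)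
      then have "integral {c..y} (\<lambda>t. H (x, t) - H (a, t)) + \<i> * integral {a..x} (\<lambda>t. H (t, y) - H (t, c)) = 0"
        by (simp only: I1 I2)
      moreover have "integral {c..y} (\<lambda>t. H (x, t) - H (a, t)) = integral {c..y} (\<lambda>t. H (x, t)) - integral {c..y} (\<lambda>t. H (a, t))"
        using x y by (intro Henstock_Kurzweil_Integration.integral_diff integrable_continuous_interval continuous_on_subset[OF Hy]) auto
      moreover have "integral {a..x} (\<lambda>t. H (t, y) - H (t, c)) = integral {a..x} (\<lambda>t. H (t, y)) - integral {a..x} (\<lambda>t. H (t, c))"
        using x y by (intro Henstock_Kurzweil_Integration.integral_diff integrable_continuous_interval continuous_on_subset[OF Hx]) auto
      ultimately show ?thesis
        unfolding F_def by (simp add: complex_eq_iff algebra_simps)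
    qed
    define Q where "Q = {z. Re z \<in> {a<..<b} \<and> Im z \<in> {c<..<d}}"
    have Q: "open Q"
    proof -
      have "Q = {z. a < Re z} \<inter> {z. Re z < b} \<inter> ({z. c < Im z} \<inter> {z. Im z < d})"
        by (auto simp: Q_def)
      then show ?thesis
        by (metis open_Int open_halfspace_Re_gt open_halfspace_Re_lt open_halfspace_Im_gt open_halfspace_Im_lt)
    qed
    have "((\<lambda>z. F (Re z) (Im z)) has_field_derivative h z) (at z)" if z: "z \<in> Q" for z
    proof -
      let ?x = "Re z" and ?y = "Im z"
      let ?X = "{a<..<b}" and ?Y = "{c<..<d}"
      have xy: "?x \<in> ?X" "?y \<in> ?Y" using z by (auto simp: Q_def)
      have fx: "((\<lambda>x. F x ?y) has_derivative (\<lambda>t. t *\<^sub>R H (?x, ?y))) (at ?x within ?X)"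
      proof -
        have "((\<lambda>u. integral {a..u} (\<lambda>t. H (t, ?y))) has_vector_derivative H (?x, ?y)) (at ?x within {a..b})"
          using xy by (intro integral_has_vector_derivative Hx) auto
        then have "((\<lambda>u. \<i> * integral {c..?y} (\<lambda>t. H (a, t)) + integral {a..u} (\<lambda>t. H (t, ?y)))
            has_vector_derivative 0 + H (?x, ?y)) (at ?x within ?X)"
          by (intro has_vector_derivative_add has_vector_derivative_const) (rule has_vector_derivative_within_subset, auto)
        then have "((\<lambda>u. F u ?y) has_vector_derivative 0 + H (?x, ?y)) (at ?x within ?X)"
          by (rule has_vector_derivative_transform[rotated 2]) (use xy F_alt in auto)
        then show ?thesis by (simp add: has_vector_derivative_def)
      qed
      have fy: "((\<lambda>y. F x y) has_derivative blinfun_apply (blinfun_scaleR_left (\<i> * H (x, y)))) (at y within ?Y)"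
        if "x \<in> ?X" "y \<in> ?Y" for x y
      proof -
        have "((\<lambda>u. integral {c..u} (\<lambda>t. H (x, t))) has_vector_derivative H (x, y)) (at y within {c..d})"
          using that by (intro integral_has_vector_derivative Hy) auto
        then have "((\<lambda>u. integral {c..u} (\<lambda>t. H (x, t))) has_vector_derivative H (x, y)) (at y within ?Y)"
          by (rule has_vector_derivative_within_subset) auto
        then have "((\<lambda>u. F x u) has_vector_derivative 0 + \<i> * H (x, y)) (at y within ?Y)"
          unfolding F_def by (intro has_vector_derivative_add has_vector_derivative_const has_vector_derivative_mult_right)
        then show ?thesis by (simp add: has_vector_derivative_def)
      qed
      have cont: "continuous (at (?x, ?y) within ?X \<times> ?Y) (\<lambda>(x, y). blinfun_scaleR_left (\<i> * H (x, y)))"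
      proof -
        have "continuous_on (?X \<times> ?Y) (\<lambda>p. blinfun_scaleR_left (\<i> * H p))"
          by (intro continuous_intros continuous_on_subset[OF H]) auto
        then show ?thesis using xy by (simp add: continuous_on_eq_continuous_within case_prod_unfold)
      qed
      have "((\<lambda>(x, y). F x y) has_derivative (\<lambda>(tx, ty). tx *\<^sub>R H (?x, ?y) + blinfun_scaleR_left (\<i> * H (?x, ?y)) ty))
          (at (?x, ?y) within ?X \<times> ?Y)"
        by (rule has_derivative_partialsI[OF fx fy cont]) (use xy in auto)
      moreover have "at (?x, ?y) within ?X \<times> ?Y = at (?x, ?y)"
        using xy by (intro at_within_open open_Times) auto
      ultimately have D: "((\<lambda>(x, y). F x y) has_derivative (\<lambda>(tx, ty). tx *\<^sub>R H (?x, ?y) + blinfun_scaleR_left (\<i> * H (?x, ?y)) ty))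
          (at (?x, ?y))" by simp
      have "((\<lambda>z. (Re z, Im z)) has_derivative (\<lambda>z. (Re z, Im z))) (at z)"
        by (intro derivative_intros)
      from has_derivative_compose[OF this D]
      have "((\<lambda>z. F (Re z) (Im z)) has_derivative (\<lambda>w. Re w *\<^sub>R h z + Im w *\<^sub>R (\<i> * h z))) (at z)"
        by (simp add: H_def)
      moreover have "(\<lambda>w. Re w *\<^sub>R h z + Im w *\<^sub>R (\<i> * h z)) = (*) (h z)"
        by (auto simp: complex_eq_iff algebra_simps)
      ultimately show ?thesis by (simp add: has_field_derivative_def)
    qed
    then have der: "\<And>z. z \<in> Q \<Longrightarrow> ((\<lambda>z. F (Re z) (Im z)) has_field_derivative h z) (at z)" .
    then have "(\<lambda>z. F (Re z) (Im z)) holomorphic_on Q"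
      using Q holomorphic_on_open by blast
    then have "deriv (\<lambda>z. F (Re z) (Im z)) holomorphic_on Q"
      using Q by (rule holomorphic_deriv)
    then have "h holomorphic_on Q"
      by (rule holomorphic_transform) (use der DERIV_imp_deriv in blast)
    moreover have "z0 \<in> Q" using r by (simp add: Q_def abcd_def)
    ultimately show ?thesis using Q by blast
  qed
  then have "h field_differentiable (at z0)" if "z0 \<in> U" for z0
    using that by (meson holomorphic_on_imp_differentiable_at)
  then show ?thesis
    by (auto simp: holomorphic_on_def intro: field_differentiable_at_within)
qed

section \<open>Covering by countably many lines\<close>

lemma rational_rect_neighbourhood:
  assumes v: "v \<in> {1, \<i>}" and U: "open U" and w: "w \<in> U"
  obtains a b c d where "a \<in> \<rat>" "b \<in> \<rat>" "c \<in> \<rat>" "d \<in> \<rat>" "a < b" "c < d"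
    "rect v a b c d \<subseteq> U" "w \<in> rect v a b c d"
proof -
  let ?v = "\<i> * cnj v"
  obtain r where r: "r > 0" "cball w r \<subseteq> U"
    using open_contains_cball[THEN iffD1, OF U] w by blast
  obtain a where a: "a \<in> \<rat>" "w \<bullet> v - r / 2 < a" "a < w \<bullet> v"
    using Rats_dense_in_real[of "w \<bullet> v - r / 2" "w \<bullet> v"] r(1) by auto
  obtain b where b: "b \<in> \<rat>" "w \<bullet> v < b" "b < w \<bullet> v + r / 2"
    using Rats_dense_in_real[of "w \<bullet> v" "w \<bullet> v + r / 2"] r(1) by auto
  obtain c where c: "c \<in> \<rat>" "w \<bullet> ?v - r / 2 < c" "c < w \<bullet> ?v"
    using Rats_dense_in_real[of "w \<bullet> ?v - r / 2" "w \<bullet> ?v"] r(1) by auto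
  obtain d where d: "d \<in> \<rat>" "w \<bullet> ?v < d" "d < w \<bullet> ?v + r / 2"
    using Rats_dense_in_real[of "w \<bullet> ?v" "w \<bullet> ?v + r / 2"] r(1) by auto
  have "rect v a b c d \<subseteq> cball w r"
  proof
    fix z assume "z \<in> rect v a b c d"
    then have "\<bar>(w - z) \<bullet> v\<bar> \<le> r / 2" "\<bar>(w - z) \<bullet> ?v\<bar> \<le> r / 2"
      using a b c d by (auto simp: rect_def inner_diff_left abs_if)
    moreover have "\<bar>Re (w - z)\<bar> + \<bar>Im (w - z)\<bar> = \<bar>(w - z) \<bullet> v\<bar> + \<bar>(w - z) \<bullet> ?v\<bar>"
      using v by (auto simp: inner_complex_def)
    ultimately have "cmod (w - z) \<le> r" using cmod_le[of "w - z"] by linarith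
    then show "z \<in> cball w r" by (simp add: dist_norm)
  qed
  then have "rect v a b c d \<subseteq> U" using r(2) by (rule order_trans)
  moreover have "w \<in> rect v a b c d" using a b c d by (simp add: rect_def)
  moreover have "a < b" "c < d" using a b c d by linarith+
  ultimately show ?thesis using that a(1) b(1) c(1) d(1) by blast
qed

text \<open>Countably many rational rectangles exhaust \<open>U\<close>, so their exceptional sets have a null union.\<close>

lemma AE_full_line_image_H1_null:
  assumes v: "v \<in> {1, \<i>}" and U: "open U" and h: "continuous_on U h"
    and wd: "has_weak_derivative U h v (g :: complex \<Rightarrow> complex)"
    and E: "E \<in> null_sets lborel" "E \<subseteq> U"
  shows "AE t in lborel. H1_null (h ` {w \<in> E. w \<bullet> (\<i> * cnj v) = t})"
proof -
  define I where "I = {(a, b, c, d) |a b c d. a \<in> \<rat> \<and> b \<in> \<rat> \<and> c \<in> \<rat> \<and> d \<in> \<rat> \<and>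
    a < b \<and> c < d \<and> rect v a b c d \<subseteq> U}"
  define S where "S = (\<lambda>(a, b, c, d) t. h ` {w \<in> E \<inter> rect v a b c d. w \<bullet> (\<i> * cnj v) = t})"
  have I: "countable I"
    by (rule countable_subset[of _ "\<rat> \<times> \<rat> \<times> \<rat> \<times> \<rat>"]) (auto simp: I_def countable_rat)
  have "AE t in lborel. H1_null (S i t)" if i: "i \<in> I" for i
  proof -
    obtain a b c d where abcd: "i = (a, b, c, d)" "a < b" "c < d" "rect v a b c d \<subseteq> U"
      using i by (auto simp: I_def)
    have "AE t in lborel. t \<in> {c..d} \<longrightarrow> H1_null (S i t)"
      unfolding S_def abcd(1) prod.case by (rule AE_line_image_H1_null[OF v abcd(2-4) U h wd E(1)])
    moreover have "H1_null (S i t)" if "t \<notin> {c..d}" for t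
    proof -
      have "S i t = {}" using that by (auto simp: S_def abcd(1) rect_def)
      then show ?thesis using H1_null_UN[of "{}"] by simp
    qed
    ultimately show ?thesis by (auto elim: eventually_mono)
  qed
  then have "AE t in lborel. \<forall>i\<in>I. H1_null (S i t)"
    using I by (simp add: AE_ball_countable)
  then show ?thesis
  proof eventually_elim
    case (elim t)
    have "h ` {w \<in> E. w \<bullet> (\<i> * cnj v) = t} \<subseteq> (\<Union>i\<in>I. S i t)"
    proof (rule image_subsetI)
      fix w assume w: "w \<in> {w \<in> E. w \<bullet> (\<i> * cnj v) = t}"
      then have "w \<in> U" using E(2) by blast
      then obtain a b c d where "a \<in> \<rat>" "b \<in> \<rat>" "c \<in> \<rat>" "d \<in> \<rat>" "a < b" "c < d"
          "rect v a b c d \<subseteq> U" "w \<in> rect v a b c d"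
        by (rule rational_rect_neighbourhood[OF v U])
      then have "(a, b, c, d) \<in> I" "h w \<in> S (a, b, c, d) t" using w by (auto simp: I_def S_def)
      then show "h w \<in> (\<Union>i\<in>I. S i t)" by blast
    qed
    moreover have "H1_null (\<Union>i\<in>I. S i t)" using elim by (intro H1_null_UN I) auto
    ultimately show ?case by (rule H1_null_subset[rotated])
  qed
qed

text \<open>Good lines are dense, so one coordinate projection of a nondegenerate connected set contains the
  coordinate of a good line. The exceptional point \<open>\<xi>\<close> of each fibre is avoided by shrinking the
  interval.\<close>

lemma H1_null_of_nondegenerate_fibres:
  assumes U: "open U" and h: "continuous_on U h"
    and wd: "has_weak_derivative U h 1 (g1 :: complex \<Rightarrow> complex)" "has_weak_derivative U h \<i> g2"
    and E: "E \<in> null_sets lborel" "E \<subseteq> U"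
    and fibre: "\<And>z. z \<in> Z \<Longrightarrow> \<exists>C \<xi> w1 w2. connected C \<and> C \<subseteq> insert \<xi> E \<and> w1 \<in> C \<and> w2 \<in> C \<and>
      w1 \<noteq> w2 \<and> (\<forall>w\<in>C. h w = z)"
  shows "H1_null Z"
proof -
  let ?L = "\<lambda>u t. h ` {w \<in> E. w \<bullet> u = t}"
  have AE: "AE t in lborel. H1_null (?L u t)" if "u \<in> {1, \<i>}" for u
  proof (cases "u = 1")
    case True
    then show ?thesis using AE_full_line_image_H1_null[of \<i>, OF _ U h wd(2) E] by simp
  next
    case False
    then show ?thesis using that AE_full_line_image_H1_null[of 1, OF _ U h wd(1) E] by simp
  qed
  have "\<exists>t. q < t \<and> t < r \<and> H1_null (?L u t)" if u: "u \<in> {1, \<i>}" and qr: "q < r" for u q r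
  proof (rule ccontr)
    assume "\<not> ?thesis"
    then have "AE t in lborel. t \<notin> {q<..<r}"
      using AE[OF u] by (auto elim!: eventually_mono)
    then have "emeasure lborel {q<..<r} = 0"
      by (subst (asm) AE_iff_measurable[of "{q<..<r}"]) auto
    then show False using qr by simp
  qed
  then obtain T where T: "\<And>u q r. u \<in> {1, \<i>} \<Longrightarrow> q < r \<Longrightarrow> q < T u q r \<and> T u q r < r \<and> H1_null (?L u (T u q r))"
    by metis
  define I where "I = {(u, q, r :: real) |u q r. u \<in> {1, \<i>} \<and> q \<in> \<rat> \<and> r \<in> \<rat> \<and> q < r}"
  have I: "countable I"
    by (rule countable_subset[of _ "{1, \<i>} \<times> \<rat> \<times> \<rat>"]) (auto simp: I_def countable_rat)
  have hit: "z \<in> (\<Union>(u, q, r)\<in>I. ?L u (T u q r))"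
    if C: "connected C" "C \<subseteq> insert \<xi> E" "\<forall>w\<in>C. h w = z" and w: "w1 \<in> C" "w2 \<in> C"
      and u: "u \<in> {1, \<i>}" "w1 \<bullet> u < w2 \<bullet> u" for C \<xi> w1 w2 u z
  proof -
    \<comment> \<open>A subinterval of the projection that avoids the coordinate of the exceptional point.\<close>
    obtain m where m: "w1 \<bullet> u < m" "m \<le> w2 \<bullet> u" "\<not> (w1 \<bullet> u < \<xi> \<bullet> u \<and> \<xi> \<bullet> u < m)"
    proof (cases "w1 \<bullet> u < \<xi> \<bullet> u \<and> \<xi> \<bullet> u < w2 \<bullet> u")
      case True
      then show ?thesis by (intro that[of "\<xi> \<bullet> u"]) auto
    next
      case False
      then show ?thesis using u by (intro that[of "w2 \<bullet> u"]) auto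
    qed
    obtain q where q: "q \<in> \<rat>" "w1 \<bullet> u < q" "q < m" using Rats_dense_in_real[OF m(1)] by blast
    obtain r where r: "r \<in> \<rat>" "q < r" "r < m" using Rats_dense_in_real[OF q(3)] by blast
    define t where "t = T u q r"
    have t: "q < t" "t < r" using T[OF u(1) r(2)] by (auto simp: t_def)
    have "connected ((\<lambda>w. w \<bullet> u) ` C)"
      by (intro connected_continuous_image continuous_intros C)
    then have "t \<in> (\<lambda>w. w \<bullet> u) ` C"
      using connectedD_interval[of "(\<lambda>w. w \<bullet> u) ` C" "w1 \<bullet> u" "w2 \<bullet> u" t] w t q r m by force
    then obtain w where wC: "w \<in> C" "w \<bullet> u = t" by blast
    have "w \<noteq> \<xi>" using wC m t q r by force
    then have "z \<in> ?L u t" using wC C by (intro image_eqI[of _ _ w]) auto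
    moreover have "(u, q, r) \<in> I" using u q r by (simp add: I_def)
    ultimately show ?thesis unfolding t_def by blast
  qed
  have "Z \<subseteq> (\<Union>(u, q, r)\<in>I. ?L u (T u q r))"
  proof
    fix z assume "z \<in> Z"
    then obtain C \<xi> w1 w2 where C: "connected C" "C \<subseteq> insert \<xi> E" "\<forall>w\<in>C. h w = z"
      and w: "w1 \<in> C" "w2 \<in> C" "w1 \<noteq> w2"
      using fibre by blast
    have "w1 \<bullet> 1 \<noteq> w2 \<bullet> 1 \<or> w1 \<bullet> \<i> \<noteq> w2 \<bullet> \<i>" using w(3) by (auto simp: complex_eq_iff)
    then obtain u where u: "u \<in> {1, \<i>}" "w1 \<bullet> u \<noteq> w2 \<bullet> u" by blast
    then consider "w1 \<bullet> u < w2 \<bullet> u" | "w2 \<bullet> u < w1 \<bullet> u" by linarith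
    then show "z \<in> (\<Union>(u, q, r)\<in>I. ?L u (T u q r))"
      by cases (rule hit[OF C w(1,2) u(1)], assumption, rule hit[OF C w(2,1) u(1)], assumption)
  qed
  moreover have "H1_null (\<Union>(u, q, r)\<in>I. ?L u (T u q r))"
    using T by (intro H1_null_UN I) (auto simp: I_def)
  ultimately show ?thesis by (rule H1_null_subset[rotated])
qed

section \<open>The exceptional boundary values\<close>

lemma has_weak_derivative_weak_derivative:
  "W11_loc U f \<Longrightarrow> v \<in> Basis \<Longrightarrow> has_weak_derivative U f v (weak_derivative U f v)"
  unfolding weak_derivative_def by (rule someI_ex[of "has_weak_derivative U f v"]) (simp add: W11_loc_def)

theorem theorem7:
  fixes A A' :: "real \<Rightarrow> real" and \<eta> :: "complex \<Rightarrow> real" and c p c0 c1 :: real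
    and f0 h0 f h \<Phi> :: "complex \<Rightarrow> complex" and Z :: "complex set"
  assumes A_range: "\<And>t. t \<ge> 1 \<Longrightarrow> A t \<ge> 1"
    and A_deriv: "\<And>t. t \<ge> 1 \<Longrightarrow> (A has_real_derivative A' t) (at t within {1..})"
    and A_convex: "convex_on {1..} A"
    and A_increasing: "mono_on {1..} A"
    and c_pos: "c > 0" and p_gt: "p > 1"
    and A_growth: "\<And>t. t \<ge> 1 \<Longrightarrow> A t \<ge> c * t powr p"
    and c0_pos: "c0 > 0" and c1_pos: "c1 > 0"
    and A_lower: "\<And>t. t \<ge> 1 \<Longrightarrow> c0 * A t \<le> t * A' t"
    and A_upper: "\<And>t. t \<ge> 1 \<Longrightarrow> t * A' t \<le> c1 * A t"
    and eta_smooth: "smooth_on disk \<eta>"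
    and eta_integrable: "integrable (lebesgue_on disk) \<eta>"
    and eta_ge: "\<And>z. z \<in> disk \<Longrightarrow> \<eta> z \<ge> 1"
    and f0_homeo: "homeomorphism closed_disk closed_disk f0 h0"
    and f0_distortion: "finite_distortion f0"
    and f0_energy: "energy A \<eta> f0 < \<infinity>"
    and f_minimiser: "minimiser A \<eta> p f0 h0 f h"
    and f_not_homeo: "\<not> extends_to_self_homeomorphism f"
    and h_monotone: "monotone_map (top_of_set closed_disk) (top_of_set closed_disk) h"
    and h_diffeo: "diffeomorphism_onto (f ` disk) disk h"
    and Phi_holomorphic: "\<Phi> holomorphic_on disk"
    and Phi_eq: "AE w in lebesgue_on disk.
        \<Phi> w = (if D_zero h w then 0
               else of_real (A' (real_of_ereal (distortion h w))) * dz h w * cnj (dzbar h w)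
                      * of_real (\<eta> (h w)))"
    and Z_def: "Z = {z \<in> circle. \<not> is_singleton {w \<in> closed_disk. h w = z}}"
  shows "hausdorff_measure 1 Z = 0"

proof -
  define \<Omega> where "\<Omega> = f ` disk"
  define E where "E = disk - \<Omega>"
  have Fs: "f \<in> F_space A \<eta> p f0 h0" and ps: "pseudo_inverse A \<eta> h0 f h"
    using f_minimiser by (auto simp: minimiser_def)
  have Osub: "\<Omega> \<subseteq> disk" using Fs by (auto simp: F_space_def \<Omega>_def)
  obtain k where Oopen: "open \<Omega>" and hom: "homeomorphism \<Omega> disk h k"
    using h_diffeo by (auto simp: diffeomorphism_onto_def \<Omega>_def)
  have inj: "inj_on h \<Omega>" and onto: "h ` \<Omega> = disk"
    using hom by (auto simp: homeomorphism_def intro: inj_on_inverseI)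
  have hcont: "continuous_on closed_disk h" and hfd: "finite_distortion h"
    and hbd: "\<And>w. w \<in> circle \<Longrightarrow> h w = h0 w"
    using ps by (auto simp: pseudo_inverse_def)
  have hd: "continuous_on disk h"
    using hcont ball_subset_cball by (rule continuous_on_subset)
  have hmap: "h ` closed_disk \<subseteq> closed_disk"
    and fib: "\<And>z. z \<in> closed_disk \<Longrightarrow> connected {w \<in> closed_disk. h w = z}"
    using h_monotone by (auto simp: monotone_map_def connectedin_subtopology)
  have Eb: "E \<in> sets borel" using Oopen by (auto simp: E_def)
  have w1: "has_weak_derivative disk h 1 (weak_derivative disk h 1)"
    and wi: "has_weak_derivative disk h \<i> (weak_derivative disk h \<i>)"
    using hfd by (auto simp: finite_distortion_def Basis_complex_def intro: has_weak_derivative_weak_derivative)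
  \<comment> \<open>A fibre over an interior point contains exactly one point of \<open>\<Omega>\<close>, which is then isolated in it.\<close>
  have unimodular: "cmod (h w) = 1" if w: "w \<in> E" for w
  proof (rule ccontr)
    assume "cmod (h w) \<noteq> 1"
    moreover have wd: "w \<in> closed_disk" "w \<notin> \<Omega>" using w by (auto simp: E_def)
    ultimately have "h w \<in> disk" using hmap by fastforce
    then obtain w0 where w0: "w0 \<in> \<Omega>" "h w0 = h w" using onto by (metis imageE)
    let ?C = "{x \<in> closed_disk. h x = h w}"
    have "connected ?C" using \<open>h w \<in> disk\<close> by (intro fib) auto
    moreover have only: "x = w0" if "x \<in> ?C" "x \<in> \<Omega>" for x
      using inj_onD[OF inj, of x w0] that w0 by auto
    ultimately have "\<Omega> \<inter> ?C = {} \<or> - {w0} \<inter> ?C = {}"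
      using Oopen w0(1) by (intro connectedD) auto
    moreover have "w0 \<in> \<Omega> \<inter> ?C" using w0 Osub by auto
    moreover have "w \<in> - {w0} \<inter> ?C" using wd w0 by auto
    ultimately show False by blast
  qed
  \<comment> \<open>Otherwise \<open>\<Phi>\<close> vanishes identically, \<open>h\<close> is holomorphic, and the maximum principle applies.\<close>
  have Enull: "E \<in> null_sets lborel"
  proof (rule ccontr)
    assume nn: "E \<notin> null_sets lborel"
    then have nn': "E \<notin> null_sets lebesgue"
      using Eb by (simp add: null_sets_completion_iff)
    obtain X where X: "X \<subseteq> disk" "AE w in lebesgue_on disk. w \<notin> f ` X \<longrightarrow> jac h w = 0"
      using ps by (auto simp: pseudo_inverse_def)
    have fin: "AE w in lebesgue_on disk. distortion h w < \<infinity>"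
      using hfd by (simp add: finite_distortion_def)
    have dL: "disk \<inter> space lebesgue \<in> sets lebesgue" by simp
    have "AE w in lebesgue_on disk. w \<in> E \<longrightarrow> \<Phi> w = 0"
      using X(2) fin Phi_eq
    proof eventually_elim
      case (elim w)
      show ?case
      proof
        assume "w \<in> E"
        then have "w \<notin> f ` X" using X(1) by (auto simp: E_def \<Omega>_def)
        then have "jac h w = 0" using elim(1) by blast
        then have "D_zero h w" using elim(2) by (auto simp: distortion_def split: if_splits)
        then show "\<Phi> w = 0" using elim(3) by simp
      qed
    qed
    then have ae0: "AE w in lebesgue. w \<in> E \<longrightarrow> \<Phi> w = 0"
      unfolding AE_restrict_space_iff[OF dL] by eventually_elim (auto simp: E_def)
    have zeros: "{w \<in> disk. \<Phi> w = 0} \<notin> null_sets lebesgue"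
    proof
      assume "{w \<in> disk. \<Phi> w = 0} \<in> null_sets lebesgue"
      from AE_not_in[OF this] ae0 have "AE w in lebesgue. w \<notin> E"
        by eventually_elim (auto simp: E_def)
      then have "E \<in> null_sets lebesgue"
        using Eb by (simp add: AE_iff_null_sets sets_completionI_sets)
      with nn' show False by blast
    qed
    have "\<Phi> constant_on disk"
    proof (rule ccontr)
      assume "\<not> \<Phi> constant_on disk"
      moreover have "fsigma disk"
      proof -
        obtain C :: "nat \<Rightarrow> complex set" where "\<And>n. compact (C n)" "\<Union>(range C) = disk"
          using open_Union_compact_subsets[OF open_ball] by metis
        then show ?thesis unfolding fsigma_Union_compact by (intro exI[of _ C]) auto
      qed
      ultimately have "countable {w \<in> disk. \<Phi> w = 0}"
        by (intro holomorphic_countable_zeros Phi_holomorphic) auto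
      then have "{w \<in> disk. \<Phi> w = 0} \<in> null_sets lebesgue"
        by (intro null_sets_completionI countable_imp_null_set_lborel)
      with zeros show False by blast
    qed
    moreover have "{w \<in> disk. \<Phi> w = 0} \<noteq> {}" using zeros by (metis null_sets.empty_sets)
    ultimately have Phi0: "\<And>w. w \<in> disk \<Longrightarrow> \<Phi> w = 0"
      unfolding constant_on_def by fastforce
    have "AE w in lebesgue_on disk. w \<in> disk" by (rule AE_I2) simp
    then have "AE w in lebesgue_on disk. weak_derivative disk h 1 w + \<i> * weak_derivative disk h \<i> w = 0"
      using fin Phi_eq X(2)
    proof eventually_elim
      case (elim w)
      have "dzbar h w = 0"
      proof (cases "D_zero h w")
        case True
        then show ?thesis by (simp add: D_zero_def)
      next
        case False
        then have jac: "jac h w > 0" using elim(2) by (auto simp: distortion_def split: if_splits)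
        define K where "K = real_of_ereal (distortion h w)"
        have "K = ((cmod (dz h w))\<^sup>2 + (cmod (dzbar h w))\<^sup>2) / jac h w"
          using False jac by (simp add: K_def distortion_def)
        also have "\<dots> \<ge> 1" using jac by (simp add: field_simps) (simp add: jac_def)
        finally have K: "K \<ge> 1" .
        \<comment> \<open>On \<open>K \<ge> 1\<close> the growth condition bounds \<open>K * A' K\<close> below by a positive number.\<close>
        have "0 < c0 * A K" using c0_pos A_range[OF K] by (intro mult_pos_pos) auto
        also have "\<dots> \<le> K * A' K" by (rule A_lower[OF K])
        finally have "A' K \<noteq> 0" by auto
        moreover have "\<eta> (h w) \<noteq> 0"
        proof -
          have "w \<in> f ` X" using elim(4) jac by auto
          then have "w \<in> \<Omega>" using X(1) by (auto simp: \<Omega>_def)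
          then have "h w \<in> disk" using onto by blast
          then show ?thesis using eta_ge[of "h w"] by auto
        qed
        moreover have "dz h w \<noteq> 0" using jac by (auto simp: jac_def)
        moreover have "\<Phi> w = of_real (A' K) * dz h w * cnj (dzbar h w) * of_real (\<eta> (h w))"
          using elim(3) False by (simp add: K_def)
        ultimately show ?thesis using Phi0[OF elim(1)] by simp
      qed
      then show ?case by (simp add: dzbar_def)
    qed
    then have hol: "h holomorphic_on disk"
      by (rule holomorphic_if_weak_dbar_zero[OF open_ball hd w1 wi])
    obtain w where w: "w \<in> E" using nn by (metis all_not_in_conv null_sets.empty_sets)
    have "h constant_on disk"
    proof (rule maximum_modulus_principle[OF hol, where U = disk and \<xi> = w])
      show "w \<in> disk" using w by (simp add: E_def)
      show "cmod (h z) \<le> cmod (h w)" if "z \<in> disk" for z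
      proof -
        have "h z \<in> closed_disk" using hmap that ball_subset_cball by blast
        then show ?thesis using unimodular[OF w] by simp
      qed
    qed auto
    then obtain y where y: "\<And>z. z \<in> disk \<Longrightarrow> h z = y" unfolding constant_on_def by blast
    have "disk \<subseteq> {y}" using onto Osub y by blast
    moreover have "(0 :: complex) \<in> disk" "(1 / 2 :: complex) \<in> disk" by auto
    ultimately show False by (metis singletonD subsetD zero_neq_one divide_eq_0_iff zero_neq_numeral)
  qed
  have surj: "closed_disk \<subseteq> h ` closed_disk"
  proof -
    have "closed (h ` closed_disk)"
      by (intro compact_imp_closed compact_continuous_image hcont) simp
    moreover have "disk \<subseteq> h ` closed_disk" using onto Osub ball_subset_cball by blast
    ultimately have "closure disk \<subseteq> h ` closed_disk" by (rule closure_minimal[rotated])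
    then show ?thesis by simp
  qed
  have "H1_null Z"
  proof (rule H1_null_of_nondegenerate_fibres[OF open_ball hd w1 wi Enull])
    show "E \<subseteq> disk" by (auto simp: E_def)
    fix z assume z: "z \<in> Z"
    let ?C = "{w \<in> closed_disk. h w = z}"
    have z1: "z \<in> closed_disk" "z \<notin> disk" and ns: "\<not> is_singleton ?C"
      using z unfolding Z_def by auto
    obtain u1 where u1: "u1 \<in> ?C" using surj z1(1) by blast
    have "?C \<noteq> {u1}" using ns by (metis is_singletonI)
    then obtain u2 where u2: "u2 \<in> ?C" "u2 \<noteq> u1" using u1 by blast
    have unique: "x = y" if "x \<in> ?C \<inter> circle" "y \<in> ?C \<inter> circle" for x y
    proof -
      have "h0 x = h0 y" using that hbd by auto
      moreover have "f0 (h0 x) = x" "f0 (h0 y) = y"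
        using f0_homeo that by (auto simp: homeomorphism_def)
      ultimately show ?thesis by metis
    qed
    obtain \<xi> where \<xi>: "?C \<inter> circle \<subseteq> {\<xi>}" using unique by blast
    have "?C \<subseteq> insert \<xi> E"
    proof
      fix x assume x: "x \<in> ?C"
      show "x \<in> insert \<xi> E"
      proof (cases "x \<in> circle")
        case True
        then show ?thesis using x \<xi> by blast
      next
        case False
        then have "x \<in> disk" using x by auto
        moreover have "x \<notin> \<Omega>" using x z1(2) onto by blast
        ultimately show ?thesis by (simp add: E_def)
      qed
    qed
    then show "\<exists>C \<xi> w1 w2. connected C \<and> C \<subseteq> insert \<xi> E \<and> w1 \<in> C \<and> w2 \<in> C \<and> w1 \<noteq> w2 \<and> (\<forall>w\<in>C. h w = z)"
      using fib[OF z1(1)] u1 u2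
      by (intro exI[of _ ?C] exI[of _ \<xi>] exI[of _ u1] exI[of _ u2]) auto
  qed
  then show ?thesis by (rule hausdorff_measure_1_eq_0)
qed

end
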